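(* Let $n\ge1$, let $(S,T)\in\mathbb R^{n\times n}\times\mathrm{Herm}^n$, consider the matrix $$M_{S,T}^{T_B}=\sum_{i,j=1}^nS_{ij}\,e_ie_i^*\otimes e_je_j^*+\sum_{i,j=1}^nT_{ij}\,e_je_i^*\otimes e_ie_j^*\in\mathrm{Herm}(\mathbb C^n\otimes\mathbb C^n),$$ and set $A=(S+S^T+T+T^T)/2\in\mathcal S^n$. For any integer $t\ge1$, $$M_{S,T}^{T_B}\in(\widetilde{\mathrm{DPS}}^{(t)}_n)^*\iff A\in\mathcal K^{(t-1)}_n.$$ In particular, for any $A\in\mathcal S^n$, $M_{A,0}^{T_B}\in(\widetilde{\mathrm{DPS}}^{(t)}_n)^*\iff A\in\mathcal K^{(t-1)}_n$.
   Context: $\mathcal S^n$: real symmetric $n\times n$ matrices; $\mathrm{Herm}^n$: complex Hermitian $n\times n$ matrices; $S^T$ denotes the transpose; $e_1,\ldots,e_n$ is the standard basis. ($M_{S,T}^{T_B}$ is the partial transpose with respect to the second tensor factor of $M_{S,T}=\sum_{i,j}S_{ij}e_ie_i^*\otimes e_je_j^*+\sum_{i,j}T_{ij}e_je_i^*\otimes e_je_i^*$.) For an integer $r\ge0$, $\mathcal K^{(r)}_n$ is the set of $A\in\mathcal S^n$ for which the polynomial $\left(\sum_{i=1}^nx_i^2\right)^{r}\sum_{i,j=1}^nA_{ij}x_i^2x_j^2\in\mathbb R[x_1,\ldots,x_n]$ is a sum of squares of real polynomials. Matrices in $\mathrm{Herm}((\mathbb C^n)^{\otimes(t+1)})$ are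 indexed by $[n]^{t+1}$, whose elements are written $i_0\underline i$, $i_0\in[n]$, $\underline i\in[n]^t$. $\mathrm{BS}((\mathbb C^n)^{\otimes(t+1)})$ (Bose symmetric matrices) is the set of $\rho\in\mathrm{Herm}((\mathbb C^n)^{\otimes(t+1)})$ with $\rho_{\underline i,\underline j}=\rho_{\underline i,\underline j^\sigma}$ for all $\underline i,\underline j\in[n]^{t+1}$ and $\sigma\in\mathfrak S_{t+1}$ ($\underline j^\sigma$ permutes the positions of $\underline j$). For $0\le s\le t$, the partial transpose is $(\rho^{T_{B[s]}})_{i_0\underline h\,\underline i,\ j_0\underline k\,\underline j}=\rho_{i_0\underline k\,\underline i,\ j_0\underline h\,\underline j}$ ($\underline h,\underline k\in[n]^s$, $\underline i,\underline j\in[n]^{t-s}$). The partial trace is $(\mathrm{Tr}_{B[2:t]}(\rho))_{ij,kl}=\sum_{\underline h\in[n]^{t-1}}\rho_{ij\underline h,kl\underline h}$. $\widetilde{\mathrm{DPS}}^{(t)}_n$ is the set of $\rho_{AB}\in\mathrm{Herm}(\mathbb C^n\otimes\mathbb C^n)$ for which there exists $\rho_{AB[t]}\in\mathrm{BS}((\mathbb C^n)^{\otimes(t+1)})$ with $\rho_{AB[t]}^{T_{B[s]}}\succeq0$ for $s=0,1,\ldots,\lfloor(t+1)/2\rfloor$ and $\mathrm{Tr}_{B[2:t]}(\rho_{AB[t]})=\rho_{AB}$. Its dual cone is $(\widetilde{\mathrm{DPS}}^{(t)}_n)^*=\{M\in\mathrm{Herm}(\mathbb C^n\otimes\mathbb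 C^n):\mathrm{Tr}(M\rho_{AB})\ge0\ \forall\rho_{AB}\in\widetilde{\mathrm{DPS}}^{(t)}_n\}$. *)

theory Defs
  imports
    "HOL-Analysis.Analysis"
    "HOL-Combinatorics.Permutations"
    "HOL-Library.Poly_Mapping"
    "HOL-Library.Complex_Order"
begin

text \<open>
  The index set \<open>[n]\<close>, \<open>n \<ge> 1\<close>, is a finite type \<open>'n\<close>. Operators on the tensor square are
  matrices indexed by \<open>'n \<times> 'n\<close>. Since the number \<open>t + 1\<close> of tensor factors varies, an operator
  on the \<open>(t+1)\<close>-st tensor power is a function of two index lists, of which only the values at
  lists of length \<open>t + 1\<close> matter.

  The order on the complex numbers is the one of \<^theory>\<open>HOL-Library.Complex_Order\<close>:
  \<open>0 \<le> z\<close> means that \<open>z\<close> is real and nonnegative.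
\<close>

definition Sym :: "(real^'n^'n) set" where
  "Sym = {A. transpose A = A}"

definition Herm :: "(complex^'n^'n) set" where
  "Herm = {M. \<forall>i j. M $ i $ j = cnj (M $ j $ i)}"

subsection \<open>The matrices built from \<open>S\<close> and \<open>T\<close>\<close>

text \<open>The matrix \<open>u v\<^sup>*\<close>.\<close>

definition outer :: "complex^'n \<Rightarrow> complex^'n \<Rightarrow> complex^'n^'n" where
  "outer u v = (\<chi> i j. u $ i * cnj (v $ j))"

definition kron :: "complex^'n^'n \<Rightarrow> complex^'n^'n \<Rightarrow> complex^('n::finite \<times> 'n)^('n \<times> 'n)" where
  "kron A B = (\<chi> p q. A $ fst p $ fst q * B $ snd p $ snd q)"

definition basis_vec :: "'n::finite \<Rightarrow> complex^'n" where
  "basis_vec i = axis i 1"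

definition M_ST :: "real^'n^'n \<Rightarrow> complex^'n^'n \<Rightarrow> complex^('n::finite \<times> 'n)^('n \<times> 'n)" where
  "M_ST S T =
     (\<Sum>i\<in>UNIV. \<Sum>j\<in>UNIV. map_matrix ((*) (complex_of_real (S $ i $ j)))
        (kron (outer (basis_vec i) (basis_vec i)) (outer (basis_vec j) (basis_vec j))))
   + (\<Sum>i\<in>UNIV. \<Sum>j\<in>UNIV. map_matrix ((*) (T $ i $ j))
        (kron (outer (basis_vec j) (basis_vec i)) (outer (basis_vec j) (basis_vec i))))"

definition M_ST_TB :: "real^'n^'n \<Rightarrow> complex^'n^'n \<Rightarrow> complex^('n::finite \<times> 'n)^('n \<times> 'n)" where
  "M_ST_TB S T =
     (\<Sum>i\<in>UNIV. \<Sum>j\<in>UNIV. map_matrix ((*) (complex_of_real (S $ i $ j)))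
        (kron (outer (basis_vec i) (basis_vec i)) (outer (basis_vec j) (basis_vec j))))
   + (\<Sum>i\<in>UNIV. \<Sum>j\<in>UNIV. map_matrix ((*) (T $ i $ j))
        (kron (outer (basis_vec j) (basis_vec i)) (outer (basis_vec i) (basis_vec j))))"

lemma M_ST_TB_nth:
  fixes S :: "real^'n::finite^'n"
  shows "M_ST_TB S T $ (a, b) $ (c, d) =
     (if a = c \<and> b = d then complex_of_real (S $ a $ b) else 0)
   + (if a = d \<and> b = c then T $ b $ a else 0)"
proof -
  have delta: "(\<Sum>i\<in>UNIV. \<Sum>j\<in>UNIV. if i = x \<and> j = y then z else 0) = z"
    for x y :: 'n and z :: complex
  proof -
    have "(\<Sum>j\<in>UNIV. if i = x \<and> j = y then z else 0) = (if i = x then z else 0)" for i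
      by (cases "i = x") simp_all
    then show ?thesis by simp
  qed
  have "M_ST_TB S T $ (a, b) $ (c, d) =
      (\<Sum>i\<in>UNIV. \<Sum>j\<in>UNIV. if i = a \<and> j = b then
          if a = c \<and> b = d then complex_of_real (S $ a $ b) else 0 else 0)
    + (\<Sum>i\<in>UNIV. \<Sum>j\<in>UNIV. if i = b \<and> j = a then
          if a = d \<and> b = c then T $ b $ a else 0 else 0)"
    unfolding M_ST_TB_def vector_add_component sum_component
    by (intro arg_cong2[where f = "(+)"] sum.cong refl)
       (simp_all add: map_matrix_def kron_def outer_def basis_vec_def axis_def)
  then show ?thesis
    by (simp only: delta)
qed

lemma M_ST_TB_partial_transpose:
  "M_ST_TB S T $ (a, b) $ (c, d) = M_ST S T $ (a, d) $ (c, b)"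
  unfolding M_ST_TB_def M_ST_def vector_add_component sum_component
  by (intro arg_cong2[where f = "(+)"] sum.cong refl)
     (simp_all add: map_matrix_def kron_def outer_def basis_vec_def axis_def)

lemma M_ST_TB_Herm:
  assumes "T \<in> Herm"
  shows "M_ST_TB S T \<in> Herm"
proof -
  have T: "cnj (T $ i $ j) = T $ j $ i" for i j
    by (rule sym) (use assms in \<open>unfold Herm_def, blast\<close>)
  have "M_ST_TB S T $ (a, b) $ (c, d) = cnj (M_ST_TB S T $ (c, d) $ (a, b))" for a b c d
    unfolding M_ST_TB_nth complex_cnj_add
    by (intro arg_cong2[where f = "(+)"]) (auto simp: T)
  then show ?thesis
    unfolding Herm_def mem_Collect_eq split_paired_All by blast
qed

text \<open>The matrix \<open>(S + S\<^sup>T + T + T\<^sup>T) / 2\<close>, which has real entries when \<open>T\<close> is Hermitian.\<close>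

definition A_ST :: "real^'n^'n \<Rightarrow> complex^'n^'n \<Rightarrow> real^'n^'n" where
  "A_ST S T = map_matrix Re ((1/2) *\<^sub>R
     (map_matrix complex_of_real S + transpose (map_matrix complex_of_real S)
      + T + transpose T))"

lemma of_real_A_ST:
  assumes "T \<in> Herm"
  shows "complex_of_real (A_ST S T $ i $ j) =
    (complex_of_real (S $ i $ j) + complex_of_real (S $ j $ i) + T $ i $ j + T $ j $ i) / 2"
proof -
  have "T $ i $ j = cnj (T $ j $ i)"
    using assms unfolding Herm_def by blast
  then have "Im (T $ i $ j) + Im (T $ j $ i) = 0"
    by (metis add.left_inverse cnj.simps(2))
  then show ?thesis
    by (simp add: A_ST_def map_matrix_def transpose_def complex_eq_iff)
qed

lemma A_ST_Sym: "A_ST S T \<in> Sym"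
  by (simp add: Sym_def A_ST_def map_matrix_def transpose_def vec_eq_iff algebra_simps)

subsection \<open>The cones \<open>K\<^sup>(\<^sup>r\<^sup>)\<close>\<close>

text \<open>Exponent vectors are finitely supported functions \<open>'n \<Rightarrow>\<^sub>0 nat\<close>; the ring structure on
  \<open>('n \<Rightarrow>\<^sub>0 nat) \<Rightarrow>\<^sub>0 real\<close> is convolution, so this is the ring of real polynomials in the
  variables \<open>x\<^sub>i\<close>, \<open>i :: 'n\<close>.\<close>

type_synonym 'n rpoly = "('n \<Rightarrow>\<^sub>0 nat) \<Rightarrow>\<^sub>0 real"

definition Var :: "'n \<Rightarrow> 'n rpoly" where
  "Var i = Poly_Mapping.single (Poly_Mapping.single i 1) 1"

definition Const :: "real \<Rightarrow> 'n rpoly" where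
  "Const c = Poly_Mapping.single 0 c"

definition sum_of_squares :: "'n rpoly \<Rightarrow> bool" where
  "sum_of_squares p \<longleftrightarrow> (\<exists>qs :: 'n rpoly list. p = (\<Sum>q\<leftarrow>qs. q\<^sup>2))"

definition K_cone :: "nat \<Rightarrow> (real^'n::finite^'n) set" where
  "K_cone r = {A \<in> Sym. sum_of_squares
     ((\<Sum>i\<in>UNIV. (Var i)\<^sup>2) ^ r *
      (\<Sum>i\<in>UNIV. \<Sum>j\<in>UNIV. Const (A $ i $ j) * (Var i)\<^sup>2 * (Var j)\<^sup>2))}"

subsection \<open>The cones \<open>DPS\<^sup>(\<^sup>t\<^sup>)\<close> with full Bose symmetry and their duals\<close>

type_synonym 'n tmat = "'n list \<Rightarrow> 'n list \<Rightarrow> complex"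

definition idx :: "nat \<Rightarrow> 'n list set" where
  "idx m = {is. length is = m}"

definition tHerm :: "nat \<Rightarrow> 'n tmat set" where
  "tHerm m = {\<rho>. \<forall>is\<in>idx m. \<forall>js\<in>idx m. \<rho> is js = cnj (\<rho> js is)}"

definition tpsd :: "nat \<Rightarrow> 'n::finite tmat \<Rightarrow> bool" where
  "tpsd m \<rho> \<longleftrightarrow> \<rho> \<in> tHerm m \<and>
     (\<forall>v. 0 \<le> (\<Sum>is\<in>idx m. \<Sum>js\<in>idx m. cnj (v is) * \<rho> is js * v js))"

definition BS :: "nat \<Rightarrow> 'n tmat set" where
  "BS m = {\<rho> \<in> tHerm m. \<forall>is\<in>idx m. \<forall>js\<in>idx m. \<forall>\<sigma>. \<sigma> permutes {..<m} \<longrightarrow>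
     \<rho> is js = \<rho> is (permute_list \<sigma> js)}"

text \<open>Position 0 of an index list belongs to the factor \<open>A\<close>, position \<open>k \<ge> 1\<close> to the \<open>k\<close>-th
  copy of \<open>B\<close>. The partial transpose over the first \<open>s\<close> copies of \<open>B\<close> exchanges the
  positions \<open>1, \<dots>, s\<close> of the row and column index.\<close>

definition ptrans_B :: "nat \<Rightarrow> 'n tmat \<Rightarrow> 'n tmat" where
  "ptrans_B s \<rho> is js =
     \<rho> (hd is # take s (tl js) @ drop s (tl is)) (hd js # take s (tl is) @ drop s (tl js))"

lemma ptrans_B_append:
  assumes "length h = s" "length k = s"
  shows "ptrans_B s \<rho> (i0 # h @ is) (j0 # k @ js) = \<rho> (i0 # k @ is) (j0 # h @ js)"
  using assms by (simp add: ptrans_B_def)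

definition ptrace_B :: "nat \<Rightarrow> 'n tmat \<Rightarrow> complex^('n::finite \<times> 'n)^('n \<times> 'n)" where
  "ptrace_B t \<rho> = (\<chi> p q. \<Sum>h\<in>idx (t - 1). \<rho> (fst p # snd p # h) (fst q # snd q # h))"

definition DPS :: "nat \<Rightarrow> (complex^('n::finite \<times> 'n)^('n \<times> 'n)) set" where
  "DPS t = {\<rho>AB \<in> Herm. \<exists>\<rho> \<in> BS (t + 1).
     (\<forall>s \<le> (t + 1) div 2. tpsd (t + 1) (ptrans_B s \<rho>)) \<and> ptrace_B t \<rho> = \<rho>AB}"

definition DPS_dual :: "nat \<Rightarrow> (complex^('n::finite \<times> 'n)^('n \<times> 'n)) set" where
  "DPS_dual t = {M \<in> Herm. \<forall>\<rho>AB \<in> DPS t. 0 \<le> trace (M ** \<rho>AB)}"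

end

theory Submission
  imports Defs
begin

text \<open>
  Let \<open>m = t + 1\<close>. Since \<open>\<rho>\<close> is Bose symmetric, \<open>Tr (M \<rho>\<^sub>A\<^sub>B)\<close> is the sum of
  \<open>A\<^sub>i\<^sub>j \<rho>(i j h, i j h)\<close>, so it is the value at \<open>P = (\<Sum> x\<^sub>i\<^sup>2)\<^sup>t\<^sup>-\<^sup>1 \<Sum> A\<^sub>i\<^sub>j x\<^sub>i\<^sup>2 x\<^sub>j\<^sup>2\<close>
  of the linear form \<open>l\<close> that sends \<open>x\<^bsup>2\<alpha>\<^esup>\<close> to the diagonal entry of \<open>\<rho>\<close> at \<open>\<alpha>\<close> and
  the other monomials to \<open>0\<close>.

  If \<open>P\<close> is a sum of squares \<open>q\<^sup>2\<close>, every \<open>q\<close> is homogeneous of degree \<open>m\<close>, and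
  \<open>l(q\<^sup>2)\<close> splits over the parity classes of exponents. On the class of \<open>\<epsilon>\<close> the exponents
  are \<open>\<gamma> = \<epsilon> + 2\<delta>\<close> with fixed \<open>s = |\<delta>|\<close>, and \<open>l(x\<^bsup>\<gamma>+\<gamma>'\<^esup>)\<close> is the entry of the
  \<open>s\<close>-th partial transpose at \<open>(\<epsilon> + \<delta>, \<delta>), (\<epsilon> + \<delta>', \<delta>')\<close>, whence \<open>l(q\<^sup>2) \<ge> 0\<close>.

  If \<open>P\<close> is not a sum of squares, the cone of sums of squares, being closed, is separated from
  \<open>P\<close> by a form \<open>l\<close> with \<open>l(P) < 0\<close>. The matrix with entries \<open>l(x\<^bsup>2\<alpha>\<^esup>)\<close> where row and
  column both have exponent \<open>\<alpha>\<close>, and \<open>0\<close> elsewhere, is Bose symmetric, and its partial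
  transposes are block diagonal with blocks \<open>l(x\<^bsup>\<gamma>+\<gamma>'\<^esup>)\<close>, hence positive semidefinite.
\<close>

subsection \<open>Gram matrices over a finite index set\<close>

text \<open>A Gram matrix is a single function of pairs, so that all of them lie in a product space
  and Tychonoff's theorem applies.\<close>

definition psd_on :: "'a set \<Rightarrow> ('a \<times> 'a \<Rightarrow> real) \<Rightarrow> bool" where
  "psd_on D G \<longleftrightarrow> (\<forall>x\<in>D. \<forall>y\<in>D. G (x, y) = G (y, x)) \<and>
     (\<forall>u. 0 \<le> (\<Sum>x\<in>D. \<Sum>y\<in>D. u x * u y * G (x, y)))"

lemma psd_onD_sym: "psd_on D G \<Longrightarrow> x \<in> D \<Longrightarrow> y \<in> D \<Longrightarrow> G (x, y) = G (y, x)"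
  by (simp add: psd_on_def)

lemma psd_onD: "psd_on D G \<Longrightarrow> 0 \<le> (\<Sum>x\<in>D. \<Sum>y\<in>D. u x * u y * G (x, y))"
  by (simp add: psd_on_def)

lemma psd_on_subset:
  assumes "psd_on D G" "finite D" "E \<subseteq> D"
  shows "psd_on E G"
  unfolding psd_on_def
proof (intro conjI allI ballI)
  fix u :: "'a \<Rightarrow> real"
  let ?u = "\<lambda>x. if x \<in> E then u x else 0"
  have "(\<Sum>x\<in>D. \<Sum>y\<in>D. ?u x * ?u y * G (x, y)) = (\<Sum>x\<in>E. \<Sum>y\<in>E. u x * u y * G (x, y))"
  proof -
    have "(\<Sum>x\<in>D. \<Sum>y\<in>D. ?u x * ?u y * G (x, y)) = (\<Sum>x\<in>E. \<Sum>y\<in>D. ?u x * ?u y * G (x, y))"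
      using assms by (intro sum.mono_neutral_right) auto
    also have "\<dots> = (\<Sum>x\<in>E. \<Sum>y\<in>E. ?u x * ?u y * G (x, y))"
      using assms by (intro sum.cong refl sum.mono_neutral_right) auto
    also have "\<dots> = (\<Sum>x\<in>E. \<Sum>y\<in>E. u x * u y * G (x, y))"
      by (intro sum.cong refl) auto
    finally show ?thesis .
  qed
  with psd_onD[OF assms(1), of ?u] show "0 \<le> (\<Sum>x\<in>E. \<Sum>y\<in>E. u x * u y * G (x, y))"
    by simp
qed (use assms in \<open>auto simp: psd_on_def\<close>)

lemma psd_on_diag_nonneg:
  assumes "psd_on D G" "finite D" "x \<in> D"
  shows "0 \<le> G (x, x)"
  using psd_onD[OF psd_on_subset[OF assms(1,2), of "{x}"], of "\<lambda>_. 1"] assms(3) by simp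

lemma psd_on_two:
  assumes "psd_on D G" "finite D" "x \<in> D" "y \<in> D" "x \<noteq> y"
  shows "0 \<le> s\<^sup>2 * G (x, x) + 2 * s * r * G (x, y) + r\<^sup>2 * G (y, y)"
  using psd_onD[OF psd_on_subset[OF assms(1,2), of "{x, y}"], of "\<lambda>z. if z = x then s else r"]
    assms psd_onD_sym[OF assms(1), of x y]
  by (simp add: power2_eq_square algebra_simps)

lemma psd_on_abs_le:
  assumes "psd_on D G" "finite D" "x \<in> D" "y \<in> D"
  shows "2 * \<bar>G (x, y)\<bar> \<le> G (x, x) + G (y, y)"
proof (cases "x = y")
  case True
  then show ?thesis using psd_on_diag_nonneg[OF assms(1-3)] by simp
next
  case False
  show ?thesis
    using psd_on_two[OF assms False, of 1 1] psd_on_two[OF assms False, of 1 "-1"] by simp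
qed

lemma psd_on_diag_zero:
  assumes "psd_on D G" "finite D" "x \<in> D" "y \<in> D" "G (x, x) = 0"
  shows "G (x, y) = 0"
proof (rule ccontr)
  assume nz: "G (x, y) \<noteq> 0"
  then have "x \<noteq> y" using assms by auto
  \<comment> \<open>Since \<open>G (x, x) = 0\<close>, the binary form is linear in
    \<open>s\<close>; this \<open>s\<close>, with \<open>r = 1\<close>, gives it the value
    \<open>-1\<close>.\<close>
  from psd_on_two[OF assms(1-4) this, of "- (G (y, y) + 1) / (2 * G (x, y))" 1]
  show False using nz assms(5) by (simp add: field_simps)
qed

text \<open>Cholesky elimination, one index at a time. If the pivot at \<open>a\<close> is zero, its
  row vanishes and the remaining block is enough; otherwise a rank one term removes the row and
  leaves the Schur complement, which is again positive semidefinite.\<close>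

lemma psd_on_imp_sum_rank_one:
  assumes "finite D" "psd_on D G"
  shows "\<exists>qs :: ('a \<Rightarrow> real) list. \<forall>x\<in>D. \<forall>y\<in>D. G (x, y) = (\<Sum>q\<leftarrow>qs. q x * q y)"
  using assms
proof (induction D arbitrary: G rule: finite_induct)
  case (insert a D)
  have sub: "psd_on D G"
    using psd_on_subset[OF insert.prems] insert.hyps by blast
  have sym: "G (x, a) = G (a, x)" if "x \<in> D" for x
    using psd_onD_sym[OF insert.prems, of x a] that by simp
  \<comment> \<open>The functions obtained for \<open>D\<close> are reset to \<open>0\<close> at
    \<open>a\<close>, so that they contribute nothing to the row and column of
    \<open>a\<close>.\<close>
  have upd: "(\<Sum>q\<leftarrow>map (\<lambda>q. q(a := 0)) qs. q x * q y) = (\<Sum>q\<leftarrow>qs. q x * q y)"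
    if "x \<in> D" "y \<in> D" for x y and qs :: "('a \<Rightarrow> real) list"
    using that insert.hyps(2) by (auto simp: o_def intro!: arg_cong[where f = sum_list])
  have upd0: "(\<Sum>q\<leftarrow>map (\<lambda>q. q(a := 0)) qs. q x * q y) = 0" if "x = a \<or> y = a"
    for x y and qs :: "('a \<Rightarrow> real) list"
    using that by (induction qs) auto
  show ?case
  proof (cases "G (a, a) = 0")
    case True
    obtain qs where qs: "\<forall>x\<in>D. \<forall>y\<in>D. G (x, y) = (\<Sum>q\<leftarrow>qs. q x * q y)"
      using insert.IH[OF sub] by blast
    have z: "G (a, y) = 0" if "y \<in> insert a D" for y
      using psd_on_diag_zero[OF insert.prems _ _ that True] insert.hyps by simp
    show ?thesis
    proof (intro exI ballI)
      fix x y assume "x \<in> insert a D" "y \<in> insert a D"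
      then show "G (x, y) = (\<Sum>q\<leftarrow>map (\<lambda>q. q(a := 0)) qs. q x * q y)"
        by (cases "x = a \<or> y = a") (use z sym qs upd upd0 in auto)
    qed
  next
    case False
    with psd_on_diag_nonneg[OF insert.prems] insert.hyps have pos: "G (a, a) > 0"
      by (simp add: less_le)
    define G' where "G' = (\<lambda>(x, y). G (x, y) - G (a, x) * G (a, y) / G (a, a))"
    have "psd_on D G'"
      unfolding psd_on_def
    proof (intro conjI allI ballI)
      fix x y assume "x \<in> D" "y \<in> D"
      then show "G' (x, y) = G' (y, x)"
        using psd_onD_sym[OF sub] by (simp add: G'_def mult.commute)
    next
      fix u :: "'a \<Rightarrow> real"
      define c where "c = (\<Sum>x\<in>D. u x * G (a, x))"
      \<comment> \<open>For given values of \<open>u\<close> on \<open>D\<close>, this value at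
        \<open>a\<close> minimises the form of \<open>G\<close>; the minimum is the form of
        \<open>G'\<close> at \<open>u\<close>.\<close>
      define w where "w = u(a := - c / G (a, a))"
      have w: "w x = u x" if "x \<in> D" for x
        using that insert.hyps by (auto simp: w_def)
      have "0 \<le> (\<Sum>x\<in>insert a D. \<Sum>y\<in>insert a D. w x * w y * G (x, y))"
        by (rule psd_onD[OF insert.prems])
      also have "\<dots> = w a * w a * G (a, a) + (\<Sum>y\<in>D. w a * w y * G (a, y))
          + (\<Sum>x\<in>D. w x * w a * G (x, a)) + (\<Sum>x\<in>D. \<Sum>y\<in>D. w x * w y * G (x, y))"
        using insert.hyps by (simp add: sum.distrib)
      also have "(\<Sum>y\<in>D. w a * w y * G (a, y)) = w a * c"
        by (simp add: c_def sum_distrib_left w mult.assoc)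
      also have "(\<Sum>x\<in>D. w x * w a * G (x, a)) = w a * c"
        unfolding c_def sum_distrib_left by (intro sum.cong) (simp_all add: w sym)
      also have "(\<Sum>x\<in>D. \<Sum>y\<in>D. w x * w y * G (x, y)) = (\<Sum>x\<in>D. \<Sum>y\<in>D. u x * u y * G (x, y))"
        by (simp add: w)
      also have "w a * w a * G (a, a) + w a * c + w a * c + \<dots> = \<dots> - c * c / G (a, a)"
        using pos by (simp add: w_def field_simps)
      also have "\<dots> = (\<Sum>x\<in>D. \<Sum>y\<in>D. u x * u y * G' (x, y))"
        by (simp add: c_def G'_def sum_product sum_divide_distrib sum_subtractf[symmetric]
            algebra_simps)
      finally show "0 \<le> (\<Sum>x\<in>D. \<Sum>y\<in>D. u x * u y * G' (x, y))" .
    qed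
    then obtain qs where qs: "\<forall>x\<in>D. \<forall>y\<in>D. G' (x, y) = (\<Sum>q\<leftarrow>qs. q x * q y)"
      using insert.IH by blast
    let ?q = "\<lambda>x. G (a, x) / sqrt (G (a, a))"
    have q: "?q x * ?q y = G (a, x) * G (a, y) / G (a, a)" for x y
      using pos by simp
    show ?thesis
    proof (intro exI ballI)
      fix x y assume xy: "x \<in> insert a D" "y \<in> insert a D"
      have "G (x, y) = ?q x * ?q y + (\<Sum>q\<leftarrow>map (\<lambda>q. q(a := 0)) qs. q x * q y)"
      proof (cases "x = a \<or> y = a")
        case True
        then have "G (x, y) = G (a, x) * G (a, y) / G (a, a)"
        proof
          assume "y = a"
          then show ?thesis using xy sym[of x] pos by (cases "x = a") simp_all
        qed (use pos in simp)
        then show ?thesis unfolding q upd0[OF True] by simp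
      next
        case False
        then have "G' (x, y) = (\<Sum>q\<leftarrow>qs. q x * q y)" using qs xy by blast
        with False show ?thesis unfolding q using upd[of x y] xy by (simp add: G'_def)
      qed
      then show "G (x, y) = (\<Sum>q\<leftarrow>?q # map (\<lambda>q. q(a := 0)) qs. q x * q y)"
        by simp
    qed
  qed
qed simp

text \<open>For a Gram matrix \<open>G\<close> of a form in monomials with exponents in \<open>D\<close>, this is the
  coefficient at the exponent \<open>b\<close>.\<close>

definition antidiag_sum :: "'a::ab_semigroup_add set \<Rightarrow> ('a \<times> 'a \<Rightarrow> real) \<Rightarrow> 'a \<Rightarrow> real" where
  "antidiag_sum D G b = (\<Sum>x\<in>D. \<Sum>y\<in>D. if x + y = b then G (x, y) else 0)"

text \<open>The maximiser \<open>z\<close> of a strictly convex function is a vertex of the support, so that only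
  \<open>z + z\<close> contributes to the coefficient at \<open>2z\<close>.\<close>

lemma antidiag_sum_vertex:
  fixes f :: "'a::cancel_ab_semigroup_add \<Rightarrow> real"
  assumes conv: "\<And>x y z. x + y = z + z \<Longrightarrow> x \<noteq> z \<Longrightarrow> 2 * f z < f x + f y"
    and psd: "psd_on D G" "finite D" and ex: "\<exists>x\<in>D. G (x, x) \<noteq> 0"
  obtains z where "z \<in> D" "G (z, z) > 0" "antidiag_sum D G (z + z) = G (z, z)"
    "\<And>x. x \<in> D \<Longrightarrow> G (x, x) \<noteq> 0 \<Longrightarrow> f x \<le> f z"
proof -
  let ?E = "{x \<in> D. G (x, x) \<noteq> 0}"
  have E: "finite ?E" "?E \<noteq> {}" using psd ex by auto
  obtain z where z: "z \<in> ?E" "\<And>x. x \<in> ?E \<Longrightarrow> f x \<le> f z"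
  proof -
    have "Max (f ` ?E) \<in> f ` ?E" using E by (intro Max_in) auto
    then obtain z where "z \<in> ?E" "f z = Max (f ` ?E)" by auto
    moreover have "f x \<le> Max (f ` ?E)" if "x \<in> ?E" for x
      using E that by (intro Max_ge) auto
    ultimately show ?thesis using that[of z] by simp
  qed
  have "G (z, z) > 0"
    using z(1) psd_on_diag_nonneg[OF psd] by (simp add: less_le)
  moreover have "antidiag_sum D G (z + z) = G (z, z)"
  proof -
    have nz: "(if x + y = z + z then G (x, y) else 0) = (if x = z \<and> y = z then G (z, z) else 0)"
      if "x \<in> D" "y \<in> D" for x y
    proof (cases "x + y = z + z \<and> G (x, y) \<noteq> 0")
      case True
      then have "x \<in> ?E" "y \<in> ?E"
        using that psd_on_diag_zero[OF psd] psd_onD_sym[OF psd(1)] by force+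
      then have "f x + f y \<le> 2 * f z" using z(2)[of x] z(2)[of y] by simp
      with conv[of x y z] True have "x = z" by force
      with True show ?thesis by auto
    qed (use z in auto)
    have "antidiag_sum D G (z + z) = (\<Sum>x\<in>D. \<Sum>y\<in>D. if x = z \<and> y = z then G (z, z) else 0)"
      unfolding antidiag_sum_def by (intro sum.cong refl nz)
    also have "\<dots> = (\<Sum>x\<in>D. if x = z then G (z, z) else 0)"
      using z(1) psd(2) by (intro sum.cong refl) auto
    also have "\<dots> = G (z, z)" using z(1) psd(2) by simp
    finally show ?thesis .
  qed
  ultimately show ?thesis using that z by blast
qed

text \<open>\<open>antidiag_sum D\<close> is dual to the passage from a form \<open>l\<close> to its
  moment matrix with entries \<open>l (x + y)\<close>. Applied to rank one matrices, this turns
  nonnegativity of \<open>l\<close> on squares into positivity of that matrix.\<close>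

lemma sum_antidiag_sum:
  assumes "finite D" "finite B" "\<And>x y. x \<in> D \<Longrightarrow> y \<in> D \<Longrightarrow> x + y \<in> B"
  shows "(\<Sum>b\<in>B. l b * antidiag_sum D G b) = (\<Sum>x\<in>D. \<Sum>y\<in>D. l (x + y) * G (x, y))"
proof -
  have "(\<Sum>b\<in>B. l b * antidiag_sum D G b)
      = (\<Sum>b\<in>B. \<Sum>x\<in>D. \<Sum>y\<in>D. if x + y = b then l b * G (x, y) else 0)"
    unfolding antidiag_sum_def sum_distrib_left by (intro sum.cong refl) auto
  also have "\<dots> = (\<Sum>x\<in>D. \<Sum>b\<in>B. \<Sum>y\<in>D. if x + y = b then l b * G (x, y) else 0)"
    by (rule sum.swap)
  also have "\<dots> = (\<Sum>x\<in>D. \<Sum>y\<in>D. \<Sum>b\<in>B. if x + y = b then l b * G (x, y) else 0)"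
    by (intro sum.cong refl sum.swap)
  also have "\<dots> = (\<Sum>x\<in>D. \<Sum>y\<in>D. l (x + y) * G (x, y))"
    using assms by (intro sum.cong refl) simp
  finally show ?thesis .
qed

lemma psd_on_add_scale:
  assumes "psd_on D G" "psd_on D H" "0 \<le> a" "0 \<le> e"
  shows "psd_on D (\<lambda>z. a * G z + e * H z)"
  unfolding psd_on_def
proof (intro conjI allI ballI)
  fix u
  have "(\<Sum>x\<in>D. \<Sum>y\<in>D. u x * u y * (a * G (x, y) + e * H (x, y)))
      = a * (\<Sum>x\<in>D. \<Sum>y\<in>D. u x * u y * G (x, y)) + e * (\<Sum>x\<in>D. \<Sum>y\<in>D. u x * u y * H (x, y))"
    by (simp add: sum_distrib_left sum.distrib[symmetric] algebra_simps)
  then show "0 \<le> (\<Sum>x\<in>D. \<Sum>y\<in>D. u x * u y * (a * G (x, y) + e * H (x, y)))"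
    using psd_onD[OF assms(1)] psd_onD[OF assms(2)] assms(3,4) by simp
qed (use assms in \<open>auto simp: psd_on_def\<close>)

lemma psd_on_rank_one: "psd_on D (\<lambda>(x, y). u x * u y)"
proof -
  have "(\<Sum>x\<in>D. \<Sum>y\<in>D. w x * w y * (u x * u y)) = (\<Sum>x\<in>D. w x * u x)\<^sup>2" for w
    by (simp add: power2_eq_square sum_product algebra_simps)
  then show ?thesis by (simp add: psd_on_def mult.commute)
qed

lemma psd_on_zero: "psd_on D (\<lambda>_. 0)"
  by (simp add: psd_on_def)

lemma antidiag_sum_add_scale:
  "antidiag_sum D (\<lambda>z. a * G z + e * H z) b = a * antidiag_sum D G b + e * antidiag_sum D H b"
  unfolding antidiag_sum_def sum_distrib_left sum.distrib[symmetric]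
  by (intro sum.cong refl) auto

section \<open>Compactness of bounded Gram matrices and coercivity\<close>

definition psd_trace_le :: "'a set \<Rightarrow> real \<Rightarrow> ('a \<times> 'a \<Rightarrow> real) set" where
  "psd_trace_le D r = {G. psd_on D G \<and> (\<forall>z. z \<notin> D \<times> D \<longrightarrow> G z = 0) \<and> (\<Sum>x\<in>D. G (x, x)) \<le> r}"

text \<open>The trace bounds every diagonal entry, since these are nonnegative, and they bound the
  other entries by \<open>psd_on_abs_le\<close>. So the set is a closed part of a compact box, in
  which the coordinates outside \<open>D \<times> D\<close> are pinned to \<open>0\<close>.\<close>

lemma compact_psd_trace_le:
  assumes "finite D"
  shows "compact (psd_trace_le D r)"
proof -
  let ?box = "PiE UNIV (\<lambda>z. if z \<in> D \<times> D then {-r..r} else {0::real})"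
  have "compactin (product_topology (\<lambda>_. euclidean) UNIV) ?box"
    unfolding compactin_PiE by auto
  then have box: "compact ?box"
    by (simp add: euclidean_product_topology)
  have cont: "continuous_on UNIV (\<lambda>G :: 'a \<times> 'a \<Rightarrow> real. G z)" for z
    by (rule continuous_on_product_coordinates)
  have "closed {G :: 'a \<times> 'a \<Rightarrow> real. psd_on D G}"
    unfolding psd_on_def Ball_def
    by (intro closed_Collect_conj closed_Collect_all closed_Collect_imp open_Collect_const
        closed_Collect_eq closed_Collect_le continuous_intros cont)
  moreover have "closed {G :: 'a \<times> 'a \<Rightarrow> real. (\<Sum>x\<in>D. G (x, x)) \<le> r}"
    by (intro closed_Collect_le continuous_intros cont)
  ultimately have "compact (?box \<inter> {G. psd_on D G} \<inter> {G. (\<Sum>x\<in>D. G (x, x)) \<le> r})"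
    using box by (intro compact_Int_closed)
  also have "?box \<inter> {G. psd_on D G} \<inter> {G. (\<Sum>x\<in>D. G (x, x)) \<le> r} = psd_trace_le D r"
  proof -
    have "G (x, y) \<in> {-r..r}" if G: "psd_on D G" "(\<Sum>x\<in>D. G (x, x)) \<le> r" and xy: "x \<in> D" "y \<in> D"
      for G x y
    proof -
      have "G (x, x) \<le> r" if "x \<in> D" for x
        using member_le_sum[of x D "\<lambda>x. G (x, x)"] psd_on_diag_nonneg[OF G(1) assms] that assms G(2)
        by force
      from this[OF xy(1)] this[OF xy(2)] psd_on_abs_le[OF G(1) assms xy] have "\<bar>G (x, y)\<bar> \<le> r"
        by linarith
      then show ?thesis by (simp add: abs_le_iff)
    qed
    then show ?thesis
      by (auto simp: psd_trace_le_def PiE_iff split: if_splits)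
  qed
  finally show ?thesis .
qed

lemma continuous_on_antidiag_sum: "continuous_on A (\<lambda>G. antidiag_sum D G b)"
proof -
  have "continuous_on A (\<lambda>G :: 'a \<times> 'a \<Rightarrow> real. if c then G z else 0)" for z c
    by (cases c) (auto intro: continuous_on_subset[OF continuous_on_product_coordinates])
  then show ?thesis unfolding antidiag_sum_def by (intro continuous_intros)
qed

text \<open>On the compact slice of trace \<open>1\<close> the squared norm of the coefficients
  attains its minimum, which \<open>inj\<close> makes positive. Both sides are quadratic in
  \<open>G\<close>, so rescaling by the trace gives the general case.\<close>

lemma antidiag_sum_coercive:
  assumes fin: "finite D" "finite B"
    and inj: "\<And>G. psd_on D G \<Longrightarrow> \<forall>b\<in>B. antidiag_sum D G b = 0 \<Longrightarrow> \<forall>x\<in>D. G (x, x) = 0"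
  obtains c where "c > 0"
    "\<And>G. psd_on D G \<Longrightarrow> c * (\<Sum>x\<in>D. G (x, x))\<^sup>2 \<le> (\<Sum>b\<in>B. (antidiag_sum D G b)\<^sup>2)"
proof -
  let ?N = "\<lambda>G. \<Sum>b\<in>B. (antidiag_sum D G b)\<^sup>2"
  let ?K = "psd_trace_le D 1 \<inter> {G. (\<Sum>x\<in>D. G (x, x)) \<ge> 1}"
  have K: "compact ?K"
    by (intro compact_Int_closed compact_psd_trace_le fin closed_Collect_le continuous_intros
        continuous_on_product_coordinates)
  have contN: "continuous_on ?K ?N"
    by (intro continuous_intros continuous_on_antidiag_sum)
  have "\<exists>c>0. \<forall>G\<in>?K. c \<le> ?N G"
  proof (cases "?K = {}")
    case True
    then show ?thesis by (metis equals0D zero_less_one)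
  next
    case False
    then obtain G where G: "G \<in> ?K" "\<forall>H\<in>?K. ?N G \<le> ?N H"
      using continuous_attains_inf[OF K _ contN] by blast
    have "?N G \<noteq> 0"
    proof
      assume "?N G = 0"
      then have "\<forall>b\<in>B. antidiag_sum D G b = 0"
        using fin by (simp add: sum_nonneg_eq_0_iff)
      then have "\<forall>x\<in>D. G (x, x) = 0"
        using inj G(1) by (simp add: psd_trace_le_def)
      then show False using G(1) by simp
    qed
    moreover have "?N G \<ge> 0" by (intro sum_nonneg) simp
    ultimately show ?thesis using G(2) by (intro exI[of _ "?N G"]) auto
  qed
  then obtain c where c: "c > 0" "\<And>G. G \<in> ?K \<Longrightarrow> c \<le> ?N G" by blast
  have "c * (\<Sum>x\<in>D. G (x, x))\<^sup>2 \<le> ?N G" if G: "psd_on D G" for G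
  proof (cases "(\<Sum>x\<in>D. G (x, x)) = 0")
    case True
    then show ?thesis by (simp add: sum_nonneg)
  next
    case False
    define s where "s = (\<Sum>x\<in>D. G (x, x))"
    have "s \<ge> 0" unfolding s_def using psd_on_diag_nonneg[OF G fin(1)] by (intro sum_nonneg) auto
    with False have s: "s > 0" by (simp add: s_def)
    define H where "H = (\<lambda>z. if z \<in> D \<times> D then 1 / s * G z + 0 * G z else 0)"
    have "psd_on D (\<lambda>z. 1 / s * G z + 0 * G z)"
      using s by (intro psd_on_add_scale G) auto
    then have "psd_on D H"
      by (simp add: psd_on_def H_def)
    moreover have "(\<Sum>x\<in>D. H (x, x)) = 1"
      using s by (simp add: H_def s_def sum_divide_distrib[symmetric])
    ultimately have "H \<in> ?K" by (auto simp: psd_trace_le_def H_def)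
    from c(2)[OF this] have "c \<le> ?N H" .
    also have "antidiag_sum D H b = 1 / s * antidiag_sum D G b" for b
      unfolding antidiag_sum_def sum_distrib_left by (intro sum.cong refl) (auto simp: H_def)
    then have "?N H = ?N G / s\<^sup>2"
      by (simp add: power_divide sum_divide_distrib)
    finally show ?thesis using s by (simp add: s_def[symmetric] field_simps)
  qed
  with c(1) that show ?thesis by blast
qed

section \<open>Separation from the cone by projection\<close>

lemma nonneg_if_quadratic_nonneg:
  fixes a q :: real
  assumes "\<And>e. 0 < e \<Longrightarrow> e \<le> 1 \<Longrightarrow> 0 \<le> e * a + e\<^sup>2 * q"
  shows "0 \<le> a"
proof (rule ccontr)
  assume "\<not> 0 \<le> a"
  \<comment> \<open>So small that \<open>e * q \<le> - a / 2\<close>, while \<open>a + e * q\<close>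
    must be nonnegative.\<close>
  define e where "e = min 1 (- a / (\<bar>q\<bar> + 1) / 2)"
  have e: "0 < e" "e \<le> 1" using \<open>\<not> 0 \<le> a\<close> by (auto simp: e_def field_simps)
  have "0 \<le> e * (a + e * q)" using assms[OF e] by (simp add: power2_eq_square algebra_simps)
  then have "0 \<le> a + e * q" using e by (simp add: zero_le_mult_iff)
  also have "e * q \<le> e * (\<bar>q\<bar> + 1)" using e by (intro mult_left_mono) auto
  also have "e * (\<bar>q\<bar> + 1) \<le> - a / (\<bar>q\<bar> + 1) / 2 * (\<bar>q\<bar> + 1)"
    by (intro mult_right_mono) (auto simp: e_def)
  also have "\<dots> = - a / 2" by (simp add: field_simps)
  finally show False using \<open>\<not> 0 \<le> a\<close> by simp
qed

text \<open>The separating form is the residual \<open>antidiag_sum D G - p\<close> at the Gram matrix \<open>G\<close> that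
  minimises its norm; coercivity makes the minimum attained.\<close>

lemma gram_alternative:
  fixes p :: "'a::ab_semigroup_add \<Rightarrow> real"
  assumes fin: "finite D" "finite B" and B: "\<And>x y. x \<in> D \<Longrightarrow> y \<in> D \<Longrightarrow> x + y \<in> B"
    and inj: "\<And>G. psd_on D G \<Longrightarrow> \<forall>b\<in>B. antidiag_sum D G b = 0 \<Longrightarrow> \<forall>x\<in>D. G (x, x) = 0"
  shows "(\<exists>G. psd_on D G \<and> (\<forall>b\<in>B. antidiag_sum D G b = p b)) \<or>
    (\<exists>l. (\<Sum>b\<in>B. l b * p b) < 0 \<and> (\<forall>u. 0 \<le> (\<Sum>x\<in>D. \<Sum>y\<in>D. u x * u y * l (x + y))))"
proof -
  define F where "F = (\<lambda>G. \<Sum>b\<in>B. (antidiag_sum D G b - p b)\<^sup>2)"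
  define P where "P = (\<Sum>b\<in>B. (p b)\<^sup>2)"
  obtain c where c: "c > 0"
    "\<And>G. psd_on D G \<Longrightarrow> c * (\<Sum>x\<in>D. G (x, x))\<^sup>2 \<le> (\<Sum>b\<in>B. (antidiag_sum D G b)\<^sup>2)"
    using antidiag_sum_coercive[OF fin inj] by blast
  \<comment> \<open>Beyond trace \<open>r\<close>, coercivity makes \<open>F\<close> at least
    \<open>P\<close>, its value at the zero matrix. So the minimum over the compact set is a minimum
    over all positive semidefinite matrices.\<close>
  define r where "r = 1 + 4 * P / c"
  have P0: "P \<ge> 0" by (simp add: P_def sum_nonneg)
  have r: "r \<ge> 1" using P0 c(1) by (simp add: r_def)
  have zero: "(\<lambda>_. 0) \<in> psd_trace_le D r" "F (\<lambda>_. 0) = P"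
    using r by (simp_all add: psd_trace_le_def psd_on_zero F_def P_def antidiag_sum_def)
  have "continuous_on (psd_trace_le D r) F"
    unfolding F_def by (intro continuous_intros continuous_on_antidiag_sum)
  then obtain G where G: "G \<in> psd_trace_le D r" "\<And>H. H \<in> psd_trace_le D r \<Longrightarrow> F G \<le> F H"
    using continuous_attains_inf[OF compact_psd_trace_le[OF fin(1)]] zero(1) by blast
  have psdG: "psd_on D G" using G(1) by (simp add: psd_trace_le_def)
  have min: "F G \<le> F H" if H: "psd_on D H" for H
  proof (cases "(\<Sum>x\<in>D. H (x, x)) \<le> r")
    case True
    let ?H = "\<lambda>z. if z \<in> D \<times> D then H z else 0"
    have "?H \<in> psd_trace_le D r"
      using True H by (simp add: psd_trace_le_def psd_on_def)
    moreover have "F ?H = F H"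
      by (simp add: F_def antidiag_sum_def cong: if_cong)
    ultimately show ?thesis using G(2) by metis
  next
    case False
    have "c * r \<le> c * (\<Sum>x\<in>D. H (x, x))\<^sup>2"
    proof (intro mult_left_mono)
      have "r \<le> r\<^sup>2" using r by (simp add: power2_eq_square)
      also have "\<dots> \<le> (\<Sum>x\<in>D. H (x, x))\<^sup>2" using False r by (intro power_mono) auto
      finally show "r \<le> (\<Sum>x\<in>D. H (x, x))\<^sup>2" .
    qed (use c in simp)
    also have "\<dots> \<le> (\<Sum>b\<in>B. (antidiag_sum D H b)\<^sup>2)" by (rule c(2)[OF H])
    also have "\<dots> \<le> (\<Sum>b\<in>B. 2 * (antidiag_sum D H b - p b)\<^sup>2 + 2 * (p b)\<^sup>2)"
    proof (intro sum_mono)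
      fix b
      show "(antidiag_sum D H b)\<^sup>2 \<le> 2 * (antidiag_sum D H b - p b)\<^sup>2 + 2 * (p b)\<^sup>2"
        \<comment> \<open>The difference of the two sides is exactly this square.\<close>
        using zero_le_power2[of "antidiag_sum D H b - 2 * p b"]
        by (simp add: power2_eq_square algebra_simps)
    qed
    also have "\<dots> = 2 * F H + 2 * P"
      by (simp add: F_def P_def sum.distrib sum_distrib_left)
    finally have "c * r \<le> 2 * F H + 2 * P" .
    moreover have "c * r = c + 4 * P" using c(1) by (simp add: r_def field_simps)
    ultimately have "P \<le> F H" using c(1) by simp
    with G(2)[OF zero(1)] zero(2) show ?thesis by simp
  qed
  define l where "l = (\<lambda>b. antidiag_sum D G b - p b)"
  have expand: "F (\<lambda>z. a * G z + e * H z) = F G + 2 * (\<Sum>b\<in>B. l b * (antidiag_sum D (\<lambda>z. a * G z + e * H z) b - antidiag_sum D G b))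
      + (\<Sum>b\<in>B. (antidiag_sum D (\<lambda>z. a * G z + e * H z) b - antidiag_sum D G b)\<^sup>2)" for a e H
    unfolding F_def l_def sum_distrib_left sum.distrib[symmetric]
    by (intro sum.cong refl) (simp add: power2_eq_square algebra_simps)
  \<comment> \<open>The ray \<open>G + e H\<close> stays in the cone, so the derivative of
    \<open>F\<close> at the minimiser in the direction \<open>H\<close> is nonnegative.\<close>
  have pos: "0 \<le> (\<Sum>b\<in>B. l b * antidiag_sum D H b)" if H: "psd_on D H" for H
  proof (rule nonneg_if_quadratic_nonneg)
    fix e :: real assume e: "0 < e" "e \<le> 1"
    have "F G \<le> F (\<lambda>z. 1 * G z + e * H z)"
      using e by (intro min psd_on_add_scale psdG H) auto
    also have "\<dots> = F G + 2 * (\<Sum>b\<in>B. l b * (e * antidiag_sum D H b)) + (\<Sum>b\<in>B. (e * antidiag_sum D H b)\<^sup>2)"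
      unfolding expand unfolding antidiag_sum_add_scale by simp
    also have "\<dots> = F G + 2 * (e * (\<Sum>b\<in>B. l b * antidiag_sum D H b) + e\<^sup>2 * ((\<Sum>b\<in>B. (antidiag_sum D H b)\<^sup>2) / 2))"
      by (simp add: sum_distrib_left sum_distrib_right power_mult_distrib mult_ac)
    finally show "0 \<le> e * (\<Sum>b\<in>B. l b * antidiag_sum D H b) + e\<^sup>2 * ((\<Sum>b\<in>B. (antidiag_sum D H b)\<^sup>2) / 2)"
      by simp
  qed
  \<comment> \<open>Moving from \<open>G\<close> towards the zero matrix also stays in the cone;
    this gives \<open>l\<close> a nonpositive value at the coefficients of \<open>G\<close>.\<close>
  have neg: "0 \<le> - (\<Sum>b\<in>B. l b * antidiag_sum D G b)"
  proof (rule nonneg_if_quadratic_nonneg)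
    fix e :: real assume e: "0 < e" "e \<le> 1"
    have "F G \<le> F (\<lambda>z. (1 - e) * G z + 0 * G z)"
      using e by (intro min psd_on_add_scale psdG) auto
    also have "\<dots> = F G + 2 * (\<Sum>b\<in>B. l b * (- e * antidiag_sum D G b)) + (\<Sum>b\<in>B. (- e * antidiag_sum D G b)\<^sup>2)"
      unfolding expand unfolding antidiag_sum_add_scale by (simp add: algebra_simps)
    also have "\<dots> = F G + 2 * (e * - (\<Sum>b\<in>B. l b * antidiag_sum D G b) + e\<^sup>2 * ((\<Sum>b\<in>B. (antidiag_sum D G b)\<^sup>2) / 2))"
      by (simp add: sum_distrib_left sum_distrib_right power_mult_distrib mult_ac sum_negf)
    finally show "0 \<le> e * - (\<Sum>b\<in>B. l b * antidiag_sum D G b) + e\<^sup>2 * ((\<Sum>b\<in>B. (antidiag_sum D G b)\<^sup>2) / 2)"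
      by simp
  qed
  show ?thesis
  \<comment> \<open>A zero residual means that \<open>G\<close> represents \<open>p\<close>.
    Otherwise the value of \<open>l\<close> at \<open>p\<close> is its value at the coefficients of
    \<open>G\<close>, at most zero, minus the squared norm of \<open>l\<close>.\<close>
  proof (cases "\<forall>b\<in>B. l b = 0")
    case True
    then show ?thesis using psdG by (auto simp: l_def)
  next
    case False
    then have "0 < (\<Sum>b\<in>B. (l b)\<^sup>2)"
      using fin(2) by (metis sum_pos2 zero_less_power2 zero_le_power2)
    moreover have "(\<Sum>b\<in>B. l b * p b) = (\<Sum>b\<in>B. l b * antidiag_sum D G b) - (\<Sum>b\<in>B. (l b)\<^sup>2)"
      unfolding sum_subtractf[symmetric]
      by (intro sum.cong refl) (simp add: l_def power2_eq_square algebra_simps)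
    ultimately have "(\<Sum>b\<in>B. l b * p b) < 0" using neg by simp
    moreover have "0 \<le> (\<Sum>x\<in>D. \<Sum>y\<in>D. u x * u y * l (x + y))" for u
    proof -
      have "(\<Sum>b\<in>B. l b * antidiag_sum D (\<lambda>(x, y). u x * u y) b)
          = (\<Sum>x\<in>D. \<Sum>y\<in>D. l (x + y) * (case (x, y) of (x, y) \<Rightarrow> u x * u y))"
        by (rule sum_antidiag_sum) (use fin B in auto)
      with pos[OF psd_on_rank_one[of D u]] show ?thesis by (simp add: mult.commute)
    qed
    ultimately show ?thesis by blast
  qed
qed

subsection \<open>Exponent vectors and sums of squares\<close>

abbreviation (input) "lookup \<equiv> Poly_Mapping.lookup"

abbreviation (input) "keys \<equiv> Poly_Mapping.keys"

text \<open>An index list stands for the product of its variables. Lists with the same exponent are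
  rearrangements of each other, so a Bose symmetric matrix depends only on the exponents of its
  indices.\<close>

primrec expo :: "'n list \<Rightarrow> 'n \<Rightarrow>\<^sub>0 nat" where
  "expo [] = 0"
| "expo (x # xs) = Poly_Mapping.single x 1 + expo xs"

lemma expo_append [simp]: "expo (xs @ ys) = expo xs + expo ys"
  by (induction xs) (simp_all add: add.assoc)

lemma lookup_expo: "lookup (expo xs) i = count (mset xs) i"
  by (induction xs) (simp_all add: lookup_add lookup_single)

lemma expo_eq_iff: "expo xs = expo ys \<longleftrightarrow> mset xs = mset ys"
  by (simp add: poly_mapping_eq_iff multiset_eq_iff fun_eq_iff lookup_expo)

lemma double_eq_iff [simp]: "x + x = y + y \<longleftrightarrow> x = (y :: 'n \<Rightarrow>\<^sub>0 nat)"
proof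
  assume eq: "x + x = y + y"
  show "x = y"
  proof (rule poly_mapping_eqI)
    fix i
    show "lookup x i = lookup y i"
      using arg_cong[OF eq, of "\<lambda>g. lookup g i"] by (simp add: lookup_add)
  qed
qed simp

definition edeg :: "('n::finite \<Rightarrow>\<^sub>0 nat) \<Rightarrow> nat" where
  "edeg g = (\<Sum>i\<in>UNIV. lookup g i)"

lemma edeg_add [simp]: "edeg (x + y) = edeg x + edeg y"
  by (simp add: edeg_def lookup_add sum.distrib)

lemma edeg_expo [simp]: "edeg (expo xs) = length xs"
proof (induction xs)
  case (Cons a xs)
  have "edeg (Poly_Mapping.single a 1) = 1"
    by (simp add: edeg_def lookup_single when_def)
  with Cons show ?case by simp
qed (simp add: edeg_def)

lemma ex_expo: "\<exists>xs. expo xs = (g :: 'n::finite \<Rightarrow>\<^sub>0 nat)"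
proof -
  have "count (Abs_multiset (lookup g)) = lookup g"
    by (rule count_Abs_multiset) simp
  then show ?thesis
    by (metis ex_mset lookup_expo poly_mapping_eqI)
qed

lemma finite_idx [simp]: "finite (idx m :: 'n::finite list set)"
  using finite_lists_length_eq[of "UNIV :: 'n set" m] by (simp add: idx_def)

lemma sum_idx_Suc:
  "(\<Sum>xs\<in>idx (Suc m). f xs) = (\<Sum>i\<in>(UNIV :: 'n::finite set). \<Sum>xs\<in>idx m. f (i # xs))"
proof -
  have "(idx (Suc m) :: 'n list set) = (\<lambda>(i, xs). i # xs) ` (UNIV \<times> idx m)"
    by (auto simp: idx_def length_Suc_conv image_iff)
  moreover have "inj_on (\<lambda>(i, xs). i # xs) (UNIV \<times> idx m :: ('n \<times> 'n list) set)"
    by (auto simp: inj_on_def)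
  ultimately show ?thesis
    by (simp add: sum.reindex sum.cartesian_product case_prod_unfold)
qed

lemma sum_idx_0: "(\<Sum>xs\<in>idx 0. f xs) = f ([] :: 'a list)"
proof -
  have "idx 0 = {[] :: 'a list}" by (auto simp: idx_def)
  then show ?thesis by simp
qed

lemma Var_power2: "(Var i)\<^sup>2 = Poly_Mapping.single (expo [i] + expo [i]) 1"
  by (simp add: Var_def power2_eq_square mult_single)

lemma power_sum_Var_power2:
  "(\<Sum>i\<in>UNIV. (Var i)\<^sup>2) ^ r = (\<Sum>xs\<in>idx r. Poly_Mapping.single (expo xs + expo xs) 1
    :: 'n::finite rpoly)"
proof (induction r)
  case 0
  show ?case by (simp add: sum_idx_0)
next
  case (Suc r)
  show ?case
    unfolding power_Suc Suc sum_idx_Suc sum_product unfolding Var_power2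
    by (intro sum.cong refl) (simp add: mult_single ac_simps)
qed

text \<open>Expanding the product chooses a variable for each factor: the first two entries of the
  list come from the form given by \<open>A\<close>, the other \<open>r\<close> from the power of
  the sum of squares.\<close>

lemma K_poly_expand:
  fixes A :: "real^'n::finite^'n"
  shows "(\<Sum>i\<in>UNIV. (Var i)\<^sup>2) ^ r * (\<Sum>i\<in>UNIV. \<Sum>j\<in>UNIV. Const (A $ i $ j) * (Var i)\<^sup>2 * (Var j)\<^sup>2)
    = (\<Sum>xs\<in>idx (Suc (Suc r)). Poly_Mapping.single (expo xs + expo xs) (A $ (xs ! 0) $ (xs ! 1)))"
  unfolding power_sum_Var_power2 sum_idx_Suc sum_distrib_left
  unfolding Var_power2 Const_def sum_distrib_right
  by (intro sum.cong refl) (simp add: mult_single ac_simps)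

section \<open>Linear forms and the coefficients of sums of squares\<close>

definition lin_form :: "('a \<Rightarrow> real) \<Rightarrow> ('a \<Rightarrow>\<^sub>0 real) \<Rightarrow> real" where
  "lin_form l p = (\<Sum>b\<in>keys p. l b * lookup p b)"

lemma lin_form_superset:
  assumes "finite B" "keys p \<subseteq> B"
  shows "lin_form l p = (\<Sum>b\<in>B. l b * lookup p b)"
  unfolding lin_form_def using assms by (intro sum.mono_neutral_left) (auto simp: in_keys_iff)

lemma lin_form_add: "lin_form l (p + q) = lin_form l p + lin_form l q"
proof -
  let ?B = "keys p \<union> keys q"
  show ?thesis
    using lin_form_superset[of ?B p l] lin_form_superset[of ?B q l]
      lin_form_superset[of ?B "p + q" l] keys_add[of p q]
    by (simp add: lookup_add algebra_simps sum.distrib)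
qed

lemma lin_form_0 [simp]: "lin_form l 0 = 0"
  by (simp add: lin_form_def)

lemma lin_form_sum: "lin_form l (\<Sum>x\<in>X. f x) = (\<Sum>x\<in>X. lin_form l (f x))"
  by (induction X rule: infinite_finite_induct) (simp_all add: lin_form_add)

lemma lin_form_sum_list: "lin_form l (\<Sum>x\<leftarrow>xs. f x) = (\<Sum>x\<leftarrow>xs. lin_form l (f x))"
  by (induction xs) (simp_all add: lin_form_add)

lemma lin_form_single [simp]: "lin_form l (Poly_Mapping.single b c) = l b * c"
  by (simp add: lin_form_def)

text \<open>Reading off a coefficient is itself a linear form, so \<open>lin_form_power2\<close>
  also yields the coefficients of a square.\<close>

lemma lin_form_lookup: "lin_form (\<lambda>b'. if b' = b then 1 else 0) p = lookup p b"
proof -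
  have "lin_form (\<lambda>b'. if b' = b then 1 else 0) p
      = (\<Sum>b'\<in>insert b (keys p). (if b' = b then 1 else 0) * lookup p b')"
    by (rule lin_form_superset) auto
  also have "\<dots> = (\<Sum>b'\<in>insert b (keys p). if b' = b then lookup p b' else 0)"
    by (intro sum.cong refl) simp
  also have "\<dots> = lookup p b" by (simp add: sum.delta)
  finally show ?thesis .
qed

lemma poly_mapping_eq_sum_single:
  assumes "finite D" "keys p \<subseteq> D"
  shows "p = (\<Sum>x\<in>D. Poly_Mapping.single x (lookup p x))"
proof (rule poly_mapping_eqI)
  fix k
  have "lookup (\<Sum>x\<in>D. Poly_Mapping.single x (lookup p x)) k = (\<Sum>x\<in>D. if x = k then lookup p x else 0)"
    by (simp add: lookup_sum lookup_single when_def)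
  also have "\<dots> = lookup p k" using assms by (auto simp: in_keys_iff)
  finally show "lookup p k = lookup (\<Sum>x\<in>D. Poly_Mapping.single x (lookup p x)) k" by simp
qed

lemma lin_form_power2:
  fixes q :: "'n rpoly"
  assumes "finite D" "keys q \<subseteq> D"
  shows "lin_form l (q\<^sup>2) = (\<Sum>x\<in>D. \<Sum>y\<in>D. l (x + y) * (lookup q x * lookup q y))"
proof -
  have "q\<^sup>2 = (\<Sum>x\<in>D. \<Sum>y\<in>D. Poly_Mapping.single (x + y) (lookup q x * lookup q y))"
    unfolding power2_eq_square
    by (subst (1 2) poly_mapping_eq_sum_single[OF assms]) (simp add: sum_product mult_single)
  then show ?thesis by (simp add: lin_form_sum)
qed

lemma lookup_sum_list_power2:
  fixes qs :: "'n rpoly list"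
  assumes "finite D" "\<And>q. q \<in> set qs \<Longrightarrow> keys q \<subseteq> D"
  shows "lookup (\<Sum>q\<leftarrow>qs. q\<^sup>2) b = antidiag_sum D (\<lambda>(x, y). \<Sum>q\<leftarrow>qs. lookup q x * lookup q y) b"
  using assms(2)
proof (induction qs)
  case (Cons q qs)
  have "lookup (q\<^sup>2) b = (\<Sum>x\<in>D. \<Sum>y\<in>D. if x + y = b then lookup q x * lookup q y else 0)"
  proof -
    have "lookup (q\<^sup>2) b = lin_form (\<lambda>b'. if b' = b then 1 else 0) (q\<^sup>2)"
      by (simp only: lin_form_lookup)
    also have "\<dots> = (\<Sum>x\<in>D. \<Sum>y\<in>D. (if x + y = b then 1 else 0) * (lookup q x * lookup q y))"
      using Cons.prems by (intro lin_form_power2 assms(1)) simp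
    also have "\<dots> = (\<Sum>x\<in>D. \<Sum>y\<in>D. if x + y = b then lookup q x * lookup q y else 0)"
      by (intro sum.cong refl) simp
    finally show ?thesis .
  qed
  with Cons show ?case
    by (simp add: lookup_add antidiag_sum_def sum.distrib[symmetric] if_distrib cong: if_cong)
qed (auto simp: antidiag_sum_def intro!: sum.neutral)

lemma psd_on_sum_rank_one: "psd_on D (\<lambda>(x, y). \<Sum>q\<leftarrow>qs. f q x * f q y)"
proof (induction qs)
  case (Cons q qs)
  from psd_on_add_scale[OF psd_on_rank_one[of D "f q"] Cons, of 1 1]
  show ?case by (simp add: case_prod_unfold)
qed (simp add: psd_on_zero case_prod_unfold)

text \<open>The weight \<open>m\<^sup>2 + 1\<close> exceeds every value of \<open>esq m\<close> at exponents of degree \<open>m\<close>, so an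
  exponent at which \<open>esq m\<close> is not larger than at one of degree \<open>m\<close> has degree \<open>m\<close> itself.\<close>

definition esq :: "nat \<Rightarrow> ('n::finite \<Rightarrow>\<^sub>0 nat) \<Rightarrow> real" where
  "esq m g = (real m ^ 2 + 1) * (real (edeg g) - real m)\<^sup>2 + (\<Sum>i\<in>UNIV. (real (lookup g i))\<^sup>2)"

text \<open>The degree is additive, so the first summand of \<open>esq\<close> is midpoint convex;
  the sum of squared coordinates is strictly so, because \<open>x\<close> and \<open>z\<close>
  differ in some coordinate.\<close>

lemma esq_strict_midpoint_convex:
  assumes "x + y = z + z" "x \<noteq> z"
  shows "2 * esq m z < esq m x + esq m y"
proof -
  have mid: "2 * c\<^sup>2 = a\<^sup>2 + b\<^sup>2 - (a - c)\<^sup>2 * 2" if "a + b = c + c" for a b c :: real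
  proof -
    have "b = 2 * c - a" using that by simp
    show ?thesis unfolding \<open>b = 2 * c - a\<close> by (simp add: power2_eq_square algebra_simps)
  qed
  have lk: "lookup x i + lookup y i = lookup z i + lookup z i" for i
    using arg_cong[OF assms(1), of "\<lambda>g. lookup g i"] by (simp add: lookup_add)
  have dg: "edeg x + edeg y = edeg z + edeg z"
    using arg_cong[OF assms(1), of edeg] by simp
  from assms(2) obtain i where i: "lookup x i \<noteq> lookup z i"
    by (auto simp: poly_mapping_eq_iff fun_eq_iff)
  have "(\<Sum>i\<in>UNIV. 2 * (real (lookup z i))\<^sup>2) < (\<Sum>i\<in>UNIV. (real (lookup x i))\<^sup>2 + (real (lookup y i))\<^sup>2)"
  proof (rule sum_strict_mono_ex1)
    have *: "2 * (real (lookup z i))\<^sup>2 = (real (lookup x i))\<^sup>2 + (real (lookup y i))\<^sup>2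
        - (real (lookup x i) - real (lookup z i))\<^sup>2 * 2" for i
      using lk[of i] by (intro mid) linarith
    show "\<forall>i\<in>UNIV. 2 * (real (lookup z i))\<^sup>2 \<le> (real (lookup x i))\<^sup>2 + (real (lookup y i))\<^sup>2"
      unfolding * by simp
    show "\<exists>i\<in>UNIV. 2 * (real (lookup z i))\<^sup>2 < (real (lookup x i))\<^sup>2 + (real (lookup y i))\<^sup>2"
      unfolding * using i by (intro bexI[of _ i]) auto
  qed simp
  moreover have "2 * (real (edeg z) - real m)\<^sup>2 \<le> (real (edeg x) - real m)\<^sup>2 + (real (edeg y) - real m)\<^sup>2"
    using mid[of "real (edeg x) - real m" "real (edeg y) - real m" "real (edeg z) - real m"] dg by simp
  then have "(real m ^ 2 + 1) * (2 * (real (edeg z) - real m)\<^sup>2)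
      \<le> (real m ^ 2 + 1) * ((real (edeg x) - real m)\<^sup>2 + (real (edeg y) - real m)\<^sup>2)"
    by (rule mult_left_mono) simp
  ultimately show ?thesis
    by (simp add: esq_def sum.distrib sum_distrib_left[symmetric] algebra_simps)
qed

lemma esq_le:
  assumes "edeg g = m"
  shows "esq m g \<le> real m ^ 2"
proof -
  have "(\<Sum>i\<in>UNIV. (real (lookup g i))\<^sup>2) \<le> (\<Sum>i\<in>UNIV. real (lookup g i) * real m)"
  proof (rule sum_mono)
    fix i
    have "lookup g i \<le> m"
      unfolding assms[symmetric] edeg_def by (rule member_le_sum) auto
    then show "(real (lookup g i))\<^sup>2 \<le> real (lookup g i) * real m"
      by (simp add: power2_eq_square mult_left_mono)
  qed
  also have "\<dots> = real m ^ 2"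
    using assms by (simp add: edeg_def sum_distrib_right[symmetric] power2_eq_square flip: of_nat_sum)
  finally show ?thesis using assms by (simp add: esq_def)
qed

lemma edeg_eq_if_esq_le:
  assumes "esq m g \<le> real m ^ 2"
  shows "edeg g = m"
proof (rule ccontr)
  assume "edeg g \<noteq> m"
  then have "1 \<le> \<bar>real (edeg g) - real m\<bar>" by linarith
  then have "1 \<le> (real (edeg g) - real m)\<^sup>2"
    by (metis one_le_power power2_abs)
  then have "(real m ^ 2 + 1) * 1 \<le> (real m ^ 2 + 1) * (real (edeg g) - real m)\<^sup>2"
    by (intro mult_left_mono) auto
  moreover have "0 \<le> (\<Sum>i\<in>UNIV. (real (lookup g i))\<^sup>2)" by (simp add: sum_nonneg)
  ultimately show False using assms by (simp add: esq_def)
qed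

text \<open>Let \<open>z\<close> maximise \<open>esq m\<close> on the support. The coefficient at
  \<open>z + z\<close> is a positive diagonal entry that nothing cancels, so \<open>hom\<close>
  gives \<open>z\<close> degree \<open>m\<close>. Every other exponent then has \<open>esq m\<close>
  at most \<open>m^2\<close>, which forces its degree to be \<open>m\<close>.\<close>

lemma sum_of_squares_homogeneous:
  fixes qs :: "'n::finite rpoly list"
  assumes hom: "\<And>g. g + g \<in> keys (\<Sum>q\<leftarrow>qs. q\<^sup>2) \<Longrightarrow> edeg g = m"
    and q: "q \<in> set qs" and g: "g \<in> keys q"
  shows "edeg g = m"
proof -
  define D where "D = (\<Union>q\<in>set qs. keys q)"
  define G where "G = (\<lambda>(x, y). \<Sum>q\<leftarrow>qs. lookup q x * lookup q y)"
  have D: "finite D" "\<And>q. q \<in> set qs \<Longrightarrow> keys q \<subseteq> D" by (auto simp: D_def)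
  have psd: "psd_on D G" unfolding G_def by (rule psd_on_sum_rank_one)
  have "g \<in> D" using q g by (auto simp: D_def)
  have "G (g, g) \<noteq> 0"
  proof -
    have "0 < lookup q g * lookup q g"
      using g by (auto simp: in_keys_iff zero_less_mult_iff)
    also have "\<dots> \<le> G (g, g)"
      unfolding G_def prod.case using q
      by (intro member_le_sum_list) (auto simp: image_iff)
    finally show ?thesis by simp
  qed
  obtain z where z: "z \<in> D" "G (z, z) > 0" "antidiag_sum D G (z + z) = G (z, z)"
    "\<And>x. x \<in> D \<Longrightarrow> G (x, x) \<noteq> 0 \<Longrightarrow> esq m x \<le> esq m z"
    using antidiag_sum_vertex[of "esq m", OF esq_strict_midpoint_convex psd D(1)]
      \<open>g \<in> D\<close> \<open>G (g, g) \<noteq> 0\<close> by blast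
  have "lookup (\<Sum>q\<leftarrow>qs. q\<^sup>2) (z + z) = G (z, z)"
    using lookup_sum_list_power2[OF D, where b="z+z"] z(3) by (simp add: G_def)
  with z(2) have "edeg z = m" by (intro hom) (simp add: in_keys_iff)
  have "esq m g \<le> esq m z" using z(4) \<open>g \<in> D\<close> \<open>G (g, g) \<noteq> 0\<close> by blast
  also have "\<dots> \<le> real m ^ 2" using \<open>edeg z = m\<close> by (rule esq_le)
  finally show ?thesis by (rule edeg_eq_if_esq_le)
qed

subsection \<open>Bose symmetric matrices and linear forms\<close>

lemma sum_pushforward:
  fixes w :: "'c \<Rightarrow> 'b::semiring_0"
  assumes "finite D" "L ` C \<subseteq> D"
  shows "(\<Sum>d\<in>D. (\<Sum>x\<in>C. if L x = d then w x else 0) * f d) = (\<Sum>x\<in>C. w x * f (L x))"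
proof -
  have "(\<Sum>d\<in>D. (\<Sum>x\<in>C. if L x = d then w x else 0) * f d)
      = (\<Sum>d\<in>D. \<Sum>x\<in>C. if L x = d then w x * f d else 0)"
    unfolding sum_distrib_right by (intro sum.cong refl) simp
  also have "\<dots> = (\<Sum>x\<in>C. \<Sum>d\<in>D. if L x = d then w x * f d else 0)"
    by (rule sum.swap)
  also have "\<dots> = (\<Sum>x\<in>C. w x * f (L x))"
    using assms by (intro sum.cong refl) (auto simp: sum.delta)
  finally show ?thesis .
qed

text \<open>A test vector can be prescribed by weights on a family \<open>L\<close> with
  repetitions: \<open>v\<close> adds up the weights over each fibre.\<close>

lemma sum_pushforward2:
  fixes w :: "'c \<Rightarrow> 'b::comm_semiring_0"
  assumes "finite D" "L ` C \<subseteq> D"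
  defines "v \<equiv> \<lambda>d. \<Sum>x\<in>C. if L x = d then w x else 0"
  shows "(\<Sum>d\<in>D. \<Sum>e\<in>D. v d * v e * F d e) = (\<Sum>x\<in>C. \<Sum>y\<in>C. w x * w y * F (L x) (L y))"
proof -
  have "(\<Sum>d\<in>D. \<Sum>e\<in>D. v d * v e * F d e) = (\<Sum>d\<in>D. v d * (\<Sum>e\<in>D. v e * F d e))"
    by (simp add: sum_distrib_left mult.assoc)
  also have "\<dots> = (\<Sum>x\<in>C. w x * (\<Sum>e\<in>D. v e * F (L x) e))"
    unfolding v_def by (rule sum_pushforward[OF assms(1,2)])
  also have "\<dots> = (\<Sum>x\<in>C. w x * (\<Sum>y\<in>C. w y * F (L x) (L y)))"
    unfolding v_def by (subst sum_pushforward[OF assms(1,2)]) simp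
  also have "\<dots> = (\<Sum>x\<in>C. \<Sum>y\<in>C. w x * w y * F (L x) (L y))"
    by (simp add: sum_distrib_left mult.assoc)
  finally show ?thesis .
qed

text \<open>\<open>k\<close> splits the matrix into diagonal blocks. This serves both the parity
  classes of exponents and the blocks of a partial transpose.\<close>

lemma sum_blocks_nonneg:
  fixes g :: "'a \<Rightarrow> 'a \<Rightarrow> 'b::ordered_comm_monoid_add"
  assumes "finite D" and off: "\<And>x y. x \<in> D \<Longrightarrow> y \<in> D \<Longrightarrow> k x \<noteq> k y \<Longrightarrow> g x y = 0"
    and blk: "\<And>c. c \<in> k ` D \<Longrightarrow> 0 \<le> (\<Sum>x\<in>{x \<in> D. k x = c}. \<Sum>y\<in>{y \<in> D. k y = c}. g x y)"
  shows "0 \<le> (\<Sum>x\<in>D. \<Sum>y\<in>D. g x y)"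
proof -
  have inner: "(\<Sum>y\<in>D. g x y) = (\<Sum>y\<in>{y \<in> D. k y = c}. g x y)" if "x \<in> D" "k x = c" for x c
    using assms(1) that by (intro sum.mono_neutral_right ballI) (auto intro!: off)
  have "(\<Sum>x\<in>D. \<Sum>y\<in>D. g x y) = (\<Sum>c\<in>k ` D. \<Sum>x\<in>{x \<in> D. k x = c}. \<Sum>y\<in>D. g x y)"
    by (rule sum.image_gen[OF assms(1)])
  also have "\<dots> = (\<Sum>c\<in>k ` D. \<Sum>x\<in>{x \<in> D. k x = c}. \<Sum>y\<in>{y \<in> D. k y = c}. g x y)"
    by (intro sum.cong[OF refl] inner) auto
  also have "0 \<le> \<dots>" by (intro sum_nonneg blk)
  finally show ?thesis .
qed

lemma tpsd_family:
  assumes "tpsd m \<rho>" "L ` C \<subseteq> idx m"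
  shows "0 \<le> (\<Sum>x\<in>C. \<Sum>y\<in>C. complex_of_real (w x) * complex_of_real (w y) * \<rho> (L x) (L y))"
proof -
  let ?v = "\<lambda>d. \<Sum>x\<in>C. if L x = d then complex_of_real (w x) else 0"
  have cnj: "cnj (?v d) = ?v d" for d
    unfolding cnj_sum by (intro sum.cong refl) simp
  have "0 \<le> (\<Sum>is\<in>idx m. \<Sum>js\<in>idx m. cnj (?v is) * \<rho> is js * ?v js)"
    by (rule assms(1)[unfolded tpsd_def, THEN conjunct2, THEN spec, of ?v])
  also have "\<dots> = (\<Sum>is\<in>idx m. \<Sum>js\<in>idx m. ?v is * ?v js * \<rho> is js)"
    unfolding cnj by (intro sum.cong refl) (simp only: mult_ac)
  also have "\<dots> = (\<Sum>x\<in>C. \<Sum>y\<in>C. complex_of_real (w x) * complex_of_real (w y) * \<rho> (L x) (L y))"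
    by (rule sum_pushforward2[OF finite_idx assms(2)])
  finally show ?thesis .
qed

text \<open>Bose symmetry as defined permutes the column index only; taking adjoints carries it over
  to the row index.\<close>

lemma BS_mset_cong:
  assumes "\<rho> \<in> BS m" "is \<in> idx m" "js \<in> idx m" "mset is' = mset is" "mset js' = mset js"
  shows "\<rho> is js = \<rho> is' js'"
proof -
  have right: "\<rho> as bs = \<rho> as bs'" if "as \<in> idx m" "bs \<in> idx m" "mset bs' = mset bs" for as bs bs'
  proof -
    note eq = \<open>mset bs' = mset bs\<close>
    obtain p where "p permutes {..<length bs}" "permute_list p bs = bs'"
      using mset_eq_permutation[OF eq] by blast
    moreover have "length bs = m" using that(2) by (simp add: idx_def)
    ultimately show ?thesis using assms(1) that(1,2) unfolding BS_def by blast
  qed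
  have herm: "\<rho> as bs = cnj (\<rho> bs as)" if "as \<in> idx m" "bs \<in> idx m" for as bs
    using assms(1) that unfolding BS_def tHerm_def by blast
  have idx': "is' \<in> idx m" "js' \<in> idx m"
    using assms(2-5) mset_eq_length by (fastforce simp: idx_def)+
  have "\<rho> is js = \<rho> is js'" by (rule right) (use assms in auto)
  also have "\<dots> = cnj (\<rho> js' is)" using assms idx' by (intro herm)
  also have "\<rho> js' is = \<rho> js' is'" by (rule right) (use assms idx' in auto)
  also have "cnj \<dots> = \<rho> is' js'" using herm idx' by metis
  finally show ?thesis .
qed

section \<open>Halving exponents within a parity class\<close>

definition floor_half :: "('n::finite \<Rightarrow>\<^sub>0 nat) \<Rightarrow> 'n \<Rightarrow>\<^sub>0 nat" where
  "floor_half g = Abs_poly_mapping (\<lambda>i. lookup g i div 2)"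

text \<open>For \<open>g = \<epsilon> + 2 \<delta>\<close> with \<open>\<epsilon>\<close> the
  parities of \<open>g\<close>, \<open>floor_half g\<close> is \<open>\<delta>\<close> and
  \<open>ceil_half g\<close> is \<open>\<epsilon> + \<delta>\<close>.\<close>

definition ceil_half :: "('n::finite \<Rightarrow>\<^sub>0 nat) \<Rightarrow> 'n \<Rightarrow>\<^sub>0 nat" where
  "ceil_half g = Abs_poly_mapping (\<lambda>i. (lookup g i + 1) div 2)"

lemma lookup_floor_half: "lookup (floor_half g) i = lookup g i div 2"
  by (simp add: floor_half_def)

lemma lookup_ceil_half: "lookup (ceil_half g) i = (lookup g i + 1) div 2"
  by (simp add: ceil_half_def)

lemma floor_half_double [simp]: "floor_half (g + g) = g"
  by (rule poly_mapping_eqI) (simp add: lookup_floor_half lookup_add)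

lemma ceil_half_add_floor_half: "ceil_half g + floor_half g = g"
proof (rule poly_mapping_eqI)
  fix i
  have "(a + 1) div 2 + a div 2 = a" for a :: nat by presburger
  then show "lookup (ceil_half g + floor_half g) i = lookup g i"
    by (simp only: lookup_add lookup_floor_half lookup_ceil_half)
qed

text \<open>Both sides are \<open>\<epsilon> + \<delta> + \<delta>'\<close> for the common parity
  vector \<open>\<epsilon>\<close>.\<close>

lemma ceil_half_add_floor_half_swap:
  assumes "\<And>i. lookup x i mod 2 = lookup y i mod 2"
  shows "ceil_half x + floor_half y = ceil_half y + floor_half x"
proof (rule poly_mapping_eqI)
  fix i
  have "(a + 1) div 2 + b div 2 = (b + 1) div 2 + a div 2" if "a mod 2 = b mod 2" for a b :: nat
  proof -
    have "(c + 1) div 2 = c div 2 + c mod 2" for c :: nat by presburger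
    with that show ?thesis by simp
  qed
  then show "lookup (ceil_half x + floor_half y) i = lookup (ceil_half y + floor_half x) i"
    using assms[of i] by (simp only: lookup_add lookup_floor_half lookup_ceil_half)
qed

text \<open>Exponents of the same degree and parities therefore have lower halves of the same
  degree, the number of transposed factors used for that class.\<close>

lemma edeg_parity:
  "edeg g = 2 * edeg (floor_half g) + (\<Sum>i\<in>UNIV. lookup g i mod 2)"
  by (simp add: edeg_def lookup_floor_half sum_distrib_left sum.distrib[symmetric])

definition list_of_expo :: "('n::finite \<Rightarrow>\<^sub>0 nat) \<Rightarrow> 'n list" where
  "list_of_expo g = (SOME xs. expo xs = g)"

lemma expo_list_of_expo [simp]: "expo (list_of_expo g) = g"
  unfolding list_of_expo_def using ex_expo by (rule someI_ex)

lemma length_list_of_expo [simp]: "length (list_of_expo g) = edeg g"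
  by (metis edeg_expo expo_list_of_expo)

lemma sum_squares_imp_trace_nonneg:
  fixes \<rho> :: "'n::finite tmat"
  assumes BS: "\<rho> \<in> BS m" and psd: "\<And>s. s \<le> m div 2 \<Longrightarrow> tpsd m (ptrans_B s \<rho>)" and "m \<ge> 1"
    and sos: "sum_of_squares (\<Sum>xs\<in>idx m. Poly_Mapping.single (expo xs + expo xs) (a xs))"
  shows "0 \<le> (\<Sum>xs\<in>idx m. complex_of_real (a xs) * \<rho> xs xs)"
proof -
  let ?P = "\<Sum>xs\<in>idx m. Poly_Mapping.single (expo xs + expo xs) (a xs)"
  obtain qs where qs: "?P = (\<Sum>q\<leftarrow>qs. q\<^sup>2)"
    using sos unfolding sum_of_squares_def by blast
  have real: "\<rho> xs xs = complex_of_real (Re (\<rho> xs xs))" if "xs \<in> idx m" for xs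
  proof -
    have "\<rho> xs xs = cnj (\<rho> xs xs)" using BS that unfolding BS_def tHerm_def by blast
    then show ?thesis by (simp add: complex_eq_iff)
  qed
  \<comment> \<open>On doubled exponents the value is a diagonal entry of \<open>\<rho>\<close>, and
    by Bose symmetry any list with that exponent may represent it. The default \<open>0\<close>
    elsewhere annihilates products of monomials of different parity.\<close>
  define l where "l = (\<lambda>b. if \<exists>z. b = z + z
    then Re (\<rho> (list_of_expo (floor_half b)) (list_of_expo (floor_half b))) else 0)"
  have l: "l (expo xs + expo xs) = Re (\<rho> xs xs)" if "xs \<in> idx m" for xs
  proof -
    have "mset (list_of_expo (expo xs)) = mset xs"
      by (simp flip: expo_eq_iff)
    with BS_mset_cong[OF BS that that] have "\<rho> xs xs = \<rho> (list_of_expo (expo xs)) (list_of_expo (expo xs))"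
      by blast
    moreover have "\<exists>z. expo xs + expo xs = z + z" by blast
    ultimately show ?thesis by (simp add: l_def)
  qed
  have hom: "edeg g = m" if "g + g \<in> keys (\<Sum>q\<leftarrow>qs. q\<^sup>2)" for g
  proof -
    have "keys ?P \<subseteq> (\<Union>xs\<in>idx m. keys (Poly_Mapping.single (expo xs + expo xs) (a xs)))"
      by (rule keys_sum)
    also have "\<dots> \<subseteq> (\<lambda>xs. expo xs + expo xs) ` idx m" by auto
    finally have "g + g \<in> (\<lambda>xs. expo xs + expo xs) ` idx m"
      using that unfolding qs by blast
    then obtain xs where "xs \<in> idx m" "g + g = expo xs + expo xs" by blast
    then show ?thesis by (simp add: idx_def)
  qed
  have "0 \<le> lin_form l (q\<^sup>2)" if q: "q \<in> set qs" for q
  proof -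
    have deg: "edeg x = m" if "x \<in> keys q" for x
      using sum_of_squares_homogeneous[OF hom q that] by blast
    define k where "k = (\<lambda>(x :: 'n \<Rightarrow>\<^sub>0 nat) i. lookup x i mod 2)"
    have "0 \<le> (\<Sum>x\<in>keys q. \<Sum>y\<in>keys q. l (x + y) * (lookup q x * lookup q y))"
    proof (rule sum_blocks_nonneg[where k = k])
      fix x y assume "k x \<noteq> k y"
      then obtain i where i: "lookup x i mod 2 \<noteq> lookup y i mod 2" by (auto simp: k_def)
      have "x + y \<noteq> z + z" for z
      proof
        assume "x + y = z + z"
        from arg_cong[OF this, of "\<lambda>g. lookup g i"]
        have "lookup x i + lookup y i = lookup z i + lookup z i" by (simp add: lookup_add)
        with i show False by presburger
      qed
      then show "l (x + y) * (lookup q x * lookup q y) = 0" by (auto simp: l_def)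
    next
      fix c assume "c \<in> k ` keys q"
      define C where "C = {x \<in> keys q. k x = c}"
      \<comment> \<open>The parities \<open>c\<close> take up part of the degree \<open>m\<close>;
        half of the rest is the degree of every \<open>\<delta>\<close> in the class.\<close>
      define s where "s = (m - (\<Sum>i\<in>UNIV. c i)) div 2"
      have s: "edeg (floor_half x) = s" "edeg (ceil_half x) = m - s" "s \<le> m div 2"
        if "x \<in> C" for x
      proof -
        have "m = 2 * edeg (floor_half x) + (\<Sum>i\<in>UNIV. c i)"
          using edeg_parity[of x] deg[of x] that by (auto simp: C_def k_def)
        then show "edeg (floor_half x) = s" "s \<le> m div 2" by (auto simp: s_def)
        then show "edeg (ceil_half x) = m - s"
          using deg[of x] that arg_cong[OF ceil_half_add_floor_half[of x], of edeg]
          by (simp add: C_def)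
      qed
      have "C \<noteq> {}" using \<open>c \<in> k ` keys q\<close> by (auto simp: C_def)
      then have sm: "s \<le> m div 2" using s(3) by blast
      \<comment> \<open>Position \<open>0\<close>, the factor \<open>A\<close>, is never transposed
        and takes a variable from \<open>ceil_half x\<close>; the \<open>s\<close> transposed
        positions carry \<open>floor_half x\<close>, the remaining ones the rest of
        \<open>ceil_half x\<close>. On \<open>C\<close> a head exists because
        \<open>m - s \<ge> 1\<close>.\<close>
      define L where "L = (\<lambda>x :: 'n \<Rightarrow>\<^sub>0 nat. hd (list_of_expo (ceil_half x)) # list_of_expo (floor_half x)
        @ tl (list_of_expo (ceil_half x)))"
      have cons: "hd (list_of_expo (ceil_half x)) # tl (list_of_expo (ceil_half x))
          = list_of_expo (ceil_half x)" if "x \<in> C" for x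
      proof -
        have "length (list_of_expo (ceil_half x)) \<noteq> 0" using s(2)[OF that] sm \<open>m \<ge> 1\<close> by simp
        then have "list_of_expo (ceil_half x) \<noteq> []" by (metis list.size(3))
        then show ?thesis by (rule list.collapse)
      qed
      have mixed: "length (hd (list_of_expo (ceil_half x)) # list_of_expo (floor_half y)
          @ tl (list_of_expo (ceil_half x))) = m"
        "expo (hd (list_of_expo (ceil_half x)) # list_of_expo (floor_half y)
          @ tl (list_of_expo (ceil_half x))) = ceil_half x + floor_half y"
        if "x \<in> C" "y \<in> C" for x y
      proof -
        have "m - s \<ge> 1" "s \<le> m" using sm \<open>m \<ge> 1\<close> by auto
        then show "length (hd (list_of_expo (ceil_half x)) # list_of_expo (floor_half y)
          @ tl (list_of_expo (ceil_half x))) = m"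
          using s that by simp
        have "expo (list_of_expo (ceil_half x)) = Poly_Mapping.single (hd (list_of_expo (ceil_half x))) 1
            + expo (tl (list_of_expo (ceil_half x)))"
          by (subst cons[OF that(1), symmetric]) simp
        then show "expo (hd (list_of_expo (ceil_half x)) # list_of_expo (floor_half y)
          @ tl (list_of_expo (ceil_half x))) = ceil_half x + floor_half y"
          by (simp add: ac_simps)
      qed
      have "L ` C \<subseteq> idx m" using mixed(1) by (auto simp: L_def idx_def)
      \<comment> \<open>The transposition exchanges the two lower halves. Equal parities then give
        row and column the same exponent, half of \<open>x + y\<close>, so the entry equals a
        diagonal one.\<close>
      have entry: "ptrans_B s \<rho> (L x) (L y) = complex_of_real (l (x + y))" if xy: "x \<in> C" "y \<in> C" for x y
      proof -
        define zs where "zs = hd (list_of_expo (ceil_half x)) # list_of_expo (floor_half y)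
          @ tl (list_of_expo (ceil_half x))"
        define zs' where "zs' = hd (list_of_expo (ceil_half y)) # list_of_expo (floor_half x)
          @ tl (list_of_expo (ceil_half y))"
        have z: "zs \<in> idx m" "zs' \<in> idx m" using mixed(1) xy by (auto simp: idx_def zs_def zs'_def)
        have ez: "expo zs = ceil_half x + floor_half y" "expo zs' = ceil_half y + floor_half x"
          unfolding zs_def zs'_def by (intro mixed xy)+
        have "lookup x i mod 2 = lookup y i mod 2" for i
          using xy by (auto simp: C_def k_def fun_eq_iff)
        then have eq: "expo zs' = expo zs"
          unfolding ez by (intro ceil_half_add_floor_half_swap) simp
        have "expo zs + expo zs = expo zs + expo zs'" by (simp add: eq)
        also have "\<dots> = (ceil_half x + floor_half x) + (ceil_half y + floor_half y)"
          by (simp add: ez ac_simps)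
        also have "\<dots> = x + y" by (simp only: ceil_half_add_floor_half)
        finally have sum: "x + y = expo zs + expo zs" by simp
        have "ptrans_B s \<rho> (L x) (L y) = \<rho> zs zs'"
          unfolding L_def zs_def zs'_def by (rule ptrans_B_append) (use s(1) xy in auto)
        also have "\<dots> = \<rho> zs zs"
          by (rule BS_mset_cong[OF BS z]) (use eq in \<open>simp_all add: expo_eq_iff\<close>)
        also have "\<dots> = complex_of_real (l (x + y))"
          unfolding sum l[OF z(1)] by (rule real[OF z(1)])
        finally show ?thesis .
      qed
      have "0 \<le> (\<Sum>x\<in>C. \<Sum>y\<in>C. complex_of_real (lookup q x) * complex_of_real (lookup q y)
          * ptrans_B s \<rho> (L x) (L y))"
        using tpsd_family[OF psd[OF sm] \<open>L ` C \<subseteq> idx m\<close>] .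
      also have "\<dots> = (\<Sum>x\<in>C. \<Sum>y\<in>C. complex_of_real (l (x + y) * (lookup q x * lookup q y)))"
        by (intro sum.cong refl) (simp add: entry mult_ac)
      also have "\<dots> = complex_of_real (\<Sum>x\<in>C. \<Sum>y\<in>C. l (x + y) * (lookup q x * lookup q y))"
        by simp
      finally show "0 \<le> (\<Sum>x\<in>{x \<in> keys q. k x = c}. \<Sum>y\<in>{y \<in> keys q. k y = c}.
          l (x + y) * (lookup q x * lookup q y))"
        by (simp add: C_def less_eq_complex_def)
    qed simp
    then show ?thesis by (simp add: lin_form_power2[of "keys q"])
  qed
  then have "0 \<le> lin_form l ?P"
    unfolding qs lin_form_sum_list by (intro sum_list_nonneg) auto
  also have "\<dots> = (\<Sum>xs\<in>idx m. a xs * Re (\<rho> xs xs))"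
    unfolding lin_form_sum by (intro sum.cong refl) (simp add: l)
  finally have "0 \<le> complex_of_real (\<Sum>xs\<in>idx m. a xs * Re (\<rho> xs xs))"
    by (simp add: less_eq_complex_def)
  also have "\<dots> = (\<Sum>xs\<in>idx m. complex_of_real (a xs) * \<rho> xs xs)"
    unfolding of_real_sum of_real_mult using real by (intro sum.cong refl) metis
  finally show ?thesis .
qed

section \<open>Bose symmetric matrices from linear forms\<close>

lemma psd_on_complex:
  fixes v :: "'a \<Rightarrow> complex"
  assumes "psd_on C G"
  shows "0 \<le> (\<Sum>x\<in>C. \<Sum>y\<in>C. cnj (v x) * complex_of_real (G (x, y)) * v y)" (is "0 \<le> ?S")
proof -
  \<comment> \<open>For a real symmetric matrix the imaginary part cancels, and the real part is the
    sum of the forms at \<open>Re v\<close> and \<open>Im v\<close>.\<close>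
  have "Re ?S = (\<Sum>x\<in>C. \<Sum>y\<in>C. Re (v x) * Re (v y) * G (x, y))
      + (\<Sum>x\<in>C. \<Sum>y\<in>C. Im (v x) * Im (v y) * G (x, y))"
    by (simp add: sum.distrib[symmetric] algebra_simps)
  moreover have "Im ?S = (\<Sum>x\<in>C. \<Sum>y\<in>C. Re (v x) * Im (v y) * G (x, y))
      - (\<Sum>x\<in>C. \<Sum>y\<in>C. Im (v x) * Re (v y) * G (x, y))"
    by (simp add: sum_subtractf[symmetric] algebra_simps)
  moreover have "(\<Sum>x\<in>C. \<Sum>y\<in>C. Im (v x) * Re (v y) * G (x, y))
      = (\<Sum>x\<in>C. \<Sum>y\<in>C. Re (v x) * Im (v y) * G (x, y))"
    by (subst sum.swap) (intro sum.cong refl, simp add: psd_onD_sym[OF assms] mult.commute)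
  ultimately show ?thesis
    using psd_onD[OF assms] by (simp add: less_eq_complex_def)
qed

text \<open>Equal exponents \<open>\<alpha>\<close> make the argument \<open>2 \<alpha>\<close>; it
  is written as a sum because partial transposition preserves the sum of the row and column
  exponents, though not their equality.\<close>

definition tmat_of_form :: "(('n \<Rightarrow>\<^sub>0 nat) \<Rightarrow> real) \<Rightarrow> 'n tmat" where
  "tmat_of_form l is js =
     (if expo is = expo js then complex_of_real (l (expo is + expo js)) else 0)"

lemma tmat_of_form_BS: "tmat_of_form l \<in> BS m"
proof -
  have "expo (permute_list \<sigma> js) = expo js" if "\<sigma> permutes {..<length js}"
    for \<sigma> and js :: "'a list"
    using that by (simp add: expo_eq_iff)
  then show ?thesis
    by (auto simp: BS_def tHerm_def tmat_of_form_def idx_def)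
qed

text \<open>\<open>k\<close> is the exponent of the untransposed positions minus that of the
  transposed ones, integer valued as it may be negative. Once the transposed parts are exchanged,
  equality of the row and column exponents becomes equality of the values of
  \<open>k\<close>.\<close>

lemma ptrans_B_tmat_of_form:
  fixes s :: nat
  assumes "is \<in> idx m" "js \<in> idx m" "m \<ge> 1"
  defines "k \<equiv> \<lambda>is i. int (lookup (expo (hd is # drop s (tl is))) i) - int (lookup (expo (take s (tl is))) i)"
  shows "ptrans_B s (tmat_of_form l) is js
    = (if k is = k js then complex_of_real (l (expo is + expo js)) else 0)"
proof -
  define up where "up = (\<lambda>is :: 'a list. expo (hd is # drop s (tl is)))"
  define lo where "lo = (\<lambda>is :: 'a list. expo (take s (tl is)))"
  have split: "expo is = up is + lo is" if "is \<in> idx m" for "is"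
  proof -
    have "is = hd is # take s (tl is) @ drop s (tl is)"
      using that \<open>m \<ge> 1\<close> by (cases "is") (auto simp: idx_def)
    from arg_cong[OF this, of expo] show ?thesis
      by (simp only: up_def lo_def expo.simps expo_append add_ac)
  qed
  have 1: "expo (hd is # take s (tl js) @ drop s (tl is)) = up is + lo js" for "is" js
    by (simp add: up_def lo_def ac_simps)
  have "up is + lo js = up js + lo is \<longleftrightarrow>
      (\<forall>i. lookup (up is) i + lookup (lo js) i = lookup (up js) i + lookup (lo is) i)"
    by (simp add: poly_mapping_eq_iff fun_eq_iff lookup_add)
  also have "\<dots> \<longleftrightarrow> k is = k js"
  proof -
    have k: "k is i = int (lookup (up is) i) - int (lookup (lo is) i)" for "is" i
      by (simp only: k_def up_def lo_def)
    show ?thesis unfolding fun_eq_iff k by (intro iff_allI) linarith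
  qed
  finally have 2: "up is + lo js = up js + lo is \<longleftrightarrow> k is = k js" .
  have 3: "(up is + lo js) + (up js + lo is) = expo is + expo js"
    using split assms(1,2) by (simp add: ac_simps)
  show ?thesis
    unfolding ptrans_B_def tmat_of_form_def 1 2 3 ..
qed

text \<open>Each class of \<open>k\<close> is a principal block on which the partial transpose
  agrees with the moment matrix of \<open>l\<close>; between classes it is zero.\<close>

lemma tpsd_ptrans_B_tmat_of_form:
  fixes l :: "('n::finite \<Rightarrow>\<^sub>0 nat) \<Rightarrow> real"
  assumes psd: "psd_on (idx m) (\<lambda>(is, js). l (expo is + expo js))" and "m \<ge> 1"
  shows "tpsd m (ptrans_B s (tmat_of_form l))"
  unfolding tpsd_def
proof (intro conjI allI)
  show "ptrans_B s (tmat_of_form l) \<in> tHerm m"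
    using \<open>m \<ge> 1\<close> by (auto simp: tHerm_def ptrans_B_tmat_of_form[of _ m] add.commute)
  fix v :: "'n list \<Rightarrow> complex"
  define k where "k = (\<lambda>is i. int (lookup (expo (hd is # drop s (tl is))) i)
    - int (lookup (expo (take s (tl is))) (i::'n)))"
  have entry: "ptrans_B s (tmat_of_form l) is js
      = (if k is = k js then complex_of_real (l (expo is + expo js)) else 0)"
    if "is \<in> idx m" "js \<in> idx m" for "is" js
    unfolding k_def using that \<open>m \<ge> 1\<close> by (rule ptrans_B_tmat_of_form)
  show "0 \<le> (\<Sum>is\<in>idx m. \<Sum>js\<in>idx m. cnj (v is) * ptrans_B s (tmat_of_form l) is js * v js)"
  proof (rule sum_blocks_nonneg[where k = k])
    fix c
    let ?C = "{is \<in> idx m. k is = c}"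
    have "0 \<le> (\<Sum>is\<in>?C. \<Sum>js\<in>?C. cnj (v is) *
        complex_of_real ((\<lambda>(is, js). l (expo is + expo js)) (is, js)) * v js)"
      by (rule psd_on_complex[OF psd_on_subset[OF psd]]) auto
    also have "\<dots> = (\<Sum>is\<in>?C. \<Sum>js\<in>?C. cnj (v is) * ptrans_B s (tmat_of_form l) is js * v js)"
      by (intro sum.cong refl) (auto simp: entry)
    finally show "0 \<le> \<dots>" .
  qed (auto simp: entry)
qed

text \<open>This is \<open>gram_alternative\<close> for the exponents of degree \<open>m\<close>: a
  Gram matrix for \<open>P\<close> would split into rank one terms and make \<open>P\<close> a sum
  of squares, so the separating form must exist.\<close>

lemma ex_separating_form:
  fixes P :: "'n::finite rpoly"
  assumes nsos: "\<not> sum_of_squares P"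
    and P: "keys P \<subseteq> (\<lambda>(x, y). x + y) ` (expo ` idx m \<times> expo ` idx m)"
  shows "\<exists>l. lin_form l P < 0 \<and> psd_on (idx m) (\<lambda>(is, js). l (expo is + expo js))"
proof -
  define D :: "('n \<Rightarrow>\<^sub>0 nat) set" where "D = expo ` idx m"
  define B where "B = (\<lambda>(x, y). x + y) ` (D \<times> D)"
  have fin: "finite D" "finite B" by (simp_all add: D_def B_def)
  have B: "x + y \<in> B" if "x \<in> D" "y \<in> D" for x y using that by (auto simp: B_def)
  have PB: "keys P \<subseteq> B" using P by (simp add: B_def D_def)
  \<comment> \<open>This is what makes the cone closed: at a vertex \<open>z\<close> of the support
    the coefficient at \<open>z + z\<close> is a single positive entry, so a nonzero diagonal cannot
    give the zero polynomial.\<close>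
  have inj: "\<forall>x\<in>D. G (x, x) = 0" if G: "psd_on D G" "\<forall>b\<in>B. antidiag_sum D G b = 0" for G
  proof (rule ccontr)
    assume "\<not> (\<forall>x\<in>D. G (x, x) = 0)"
    then have ex: "\<exists>x\<in>D. G (x, x) \<noteq> 0" by blast
    obtain z where "z \<in> D" "G (z, z) > 0" "antidiag_sum D G (z + z) = G (z, z)"
      using antidiag_sum_vertex[of "esq m", OF esq_strict_midpoint_convex G(1) fin(1) ex] by blast
    with G(2) B show False by fastforce
  qed
  consider G where "psd_on D G" "\<forall>b\<in>B. antidiag_sum D G b = lookup P b"
    | l where "(\<Sum>b\<in>B. l b * lookup P b) < 0" "\<forall>u. 0 \<le> (\<Sum>x\<in>D. \<Sum>y\<in>D. u x * u y * l (x + y))"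
    using gram_alternative[OF fin B inj, of "lookup P"] by blast
  then show ?thesis
  proof cases
    case 1
    then obtain fs :: "(('n \<Rightarrow>\<^sub>0 nat) \<Rightarrow> real) list" where
      fs: "\<forall>x\<in>D. \<forall>y\<in>D. G (x, y) = (\<Sum>f\<leftarrow>fs. f x * f y)"
      using psd_on_imp_sum_rank_one[OF fin(1)] by blast
    define poly :: "(('n \<Rightarrow>\<^sub>0 nat) \<Rightarrow> real) \<Rightarrow> 'n rpoly" where
      "poly = (\<lambda>f. \<Sum>x\<in>D. Poly_Mapping.single x (f x))"
    have lp: "lookup (poly f) x = (if x \<in> D then f x else 0)" for f x
      using fin(1) by (simp add: poly_def lookup_sum lookup_single when_def)
    have "P = (\<Sum>q\<leftarrow>map poly fs. q\<^sup>2)"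
    proof (rule poly_mapping_eqI)
      fix b
      have "lookup (\<Sum>q\<leftarrow>map poly fs. q\<^sup>2) b
          = antidiag_sum D (\<lambda>(x, y). \<Sum>q\<leftarrow>map poly fs. lookup q x * lookup q y) b"
        by (rule lookup_sum_list_power2[OF fin(1)]) (auto simp: in_keys_iff lp split: if_splits)
      also have "\<dots> = antidiag_sum D G b"
        unfolding antidiag_sum_def using fs by (intro sum.cong refl) (simp add: lp o_def)
      also have "\<dots> = lookup P b"
      proof (cases "b \<in> B")
        case False
        then have "antidiag_sum D G b = 0"
          unfolding antidiag_sum_def using B by (intro sum.neutral ballI) auto
        with False PB show ?thesis by (auto simp: in_keys_iff)
      qed (use 1 in simp)
      finally show "lookup P b = lookup (\<Sum>q\<leftarrow>map poly fs. q\<^sup>2) b" ..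
    qed
    with nsos show ?thesis unfolding sum_of_squares_def by blast
  next
    case 2
    have "0 \<le> (\<Sum>is\<in>idx m. \<Sum>js\<in>idx m. u is * u js * l (expo is + expo js))" for u :: "'n list \<Rightarrow> real"
    proof -
      \<comment> \<open>Positivity is known on exponents and wanted on lists, so the weights of all
        lists with the same exponent are added.\<close>
      let ?v = "\<lambda>d. \<Sum>is\<in>idx m. if expo is = d then u is else 0"
      have "0 \<le> (\<Sum>x\<in>D. \<Sum>y\<in>D. ?v x * ?v y * l (x + y))" by (rule 2(2)[THEN spec])
      also have "\<dots> = (\<Sum>is\<in>idx m. \<Sum>js\<in>idx m. u is * u js * l (expo is + expo js))"
        by (rule sum_pushforward2[OF fin(1)]) (simp add: D_def)
      finally show ?thesis .
    qed
    then have "psd_on (idx m) (\<lambda>(is, js). l (expo is + expo js))"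
      by (simp add: psd_on_def add.commute)
    moreover have "lin_form l P < 0" using 2(1) by (simp add: lin_form_superset[OF fin(2) PB])
    ultimately show ?thesis by blast
  qed
qed

subsection \<open>The dual cone\<close>

lemma trace_M_ST_TB:
  fixes S :: "real^'n::finite^'n" and R :: "complex^('n \<times> 'n)^('n \<times> 'n)"
  shows "trace (M_ST_TB S T ** R) = (\<Sum>a\<in>UNIV. \<Sum>b\<in>UNIV.
    complex_of_real (S $ a $ b) * R $ (a, b) $ (a, b) + T $ b $ a * R $ (b, a) $ (a, b))"
proof -
  have entry: "M_ST_TB S T $ (a, b) $ q = (if q = (a, b) then complex_of_real (S $ a $ b) else 0)
      + (if q = (b, a) then T $ b $ a else 0)" for a b q
  proof -
    obtain c d where q: "q = (c, d)" by (cases q)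
    have "a = c \<and> b = d \<longleftrightarrow> q = (a, b)" "a = d \<and> b = c \<longleftrightarrow> q = (b, a)"
      unfolding q by blast+
    then show ?thesis unfolding q M_ST_TB_nth by (simp only:)
  qed
  have diag: "(\<Sum>q\<in>UNIV. M_ST_TB S T $ (a, b) $ q * R $ q $ (a, b))
      = complex_of_real (S $ a $ b) * R $ (a, b) $ (a, b) + T $ b $ a * R $ (b, a) $ (a, b)" for a b
  proof -
    have dist: "((if P then x else 0) + (if Q then y else 0)) * z
        = (if P then x * z else 0) + (if Q then y * z else 0)" for P Q and x y z :: complex
      by (simp add: distrib_right)
    have "(\<Sum>q\<in>UNIV. M_ST_TB S T $ (a, b) $ q * R $ q $ (a, b))
      = (\<Sum>q\<in>UNIV. if q = (a, b) then complex_of_real (S $ a $ b) * R $ q $ (a, b) else 0)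
      + (\<Sum>q\<in>UNIV. if q = (b, a) then T $ b $ a * R $ q $ (a, b) else 0)"
      unfolding sum.distrib[symmetric] entry by (intro sum.cong refl dist)
    then show ?thesis by simp
  qed
  have pairs: "(\<Sum>p\<in>UNIV. f p) = (\<Sum>a\<in>UNIV. \<Sum>b\<in>UNIV. f (a, b))"
    for f :: "'n \<times> 'n \<Rightarrow> complex"
    by (simp add: sum.cartesian_product flip: UNIV_Times_UNIV)
  have "trace (M_ST_TB S T ** R) = (\<Sum>p\<in>UNIV. \<Sum>q\<in>UNIV. M_ST_TB S T $ p $ q * R $ q $ p)"
    by (simp add: trace_def matrix_matrix_mult_def)
  also have "\<dots> = (\<Sum>a\<in>UNIV. \<Sum>b\<in>UNIV. \<Sum>q\<in>UNIV. M_ST_TB S T $ (a, b) $ q * R $ q $ (a, b))"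
    by (rule pairs)
  finally show ?thesis unfolding diag .
qed

text \<open>By Bose symmetry the entries of the partial trace met by \<open>S\<close> and by
  \<open>T\<close> agree, so only the sum of the two coefficients matters.\<close>

lemma trace_M_ST_TB_ptrace_B:
  fixes S :: "real^'n::finite^'n"
  assumes T: "T \<in> Herm" and BS: "\<rho> \<in> BS (Suc (Suc r))"
  shows "trace (M_ST_TB S T ** ptrace_B (Suc r) \<rho>)
    = (\<Sum>xs\<in>idx (Suc (Suc r)). complex_of_real (A_ST S T $ (xs ! 0) $ (xs ! 1)) * \<rho> xs xs)"
proof -
  define R where "R = ptrace_B (Suc r) \<rho>"
  have R: "R $ (a, b) $ (c, d) = (\<Sum>h\<in>idx r. \<rho> (a # b # h) (c # d # h))" for a b c d
    by (simp add: R_def ptrace_B_def)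
  have swap: "R $ (b, a) $ (a, b) = R $ (a, b) $ (a, b)" "R $ (b, a) $ (b, a) = R $ (a, b) $ (a, b)" for a b
    unfolding R by (intro sum.cong refl BS_mset_cong[OF BS]; auto simp: idx_def)+
  define s where "s = (\<lambda>a b. (complex_of_real (S $ a $ b) + T $ b $ a) * R $ (a, b) $ (a, b))"
  have "trace (M_ST_TB S T ** R) = (\<Sum>a\<in>UNIV. \<Sum>b\<in>UNIV. s a b)"
    unfolding trace_M_ST_TB swap s_def by (simp add: distrib_right)
  \<comment> \<open>The diagonal entries are symmetric in \<open>a\<close> and \<open>b\<close>, so
    the coefficients may be averaged with their transposes, which produces
    \<open>A_ST S T\<close>.\<close>
  also have "\<dots> = ((\<Sum>a\<in>UNIV. \<Sum>b\<in>UNIV. s a b) + (\<Sum>a\<in>UNIV. \<Sum>b\<in>UNIV. s b a)) / 2"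
    by (subst (3) sum.swap) simp
  also have "\<dots> = (\<Sum>a\<in>UNIV. \<Sum>b\<in>UNIV. complex_of_real (A_ST S T $ a $ b) * R $ (a, b) $ (a, b))"
    unfolding sum.distrib[symmetric] sum_divide_distrib
    by (intro sum.cong refl) (simp add: s_def of_real_A_ST[OF T] swap field_simps)
  also have "\<dots> = (\<Sum>xs\<in>idx (Suc (Suc r)). complex_of_real (A_ST S T $ (xs ! 0) $ (xs ! 1)) * \<rho> xs xs)"
    by (simp add: sum_idx_Suc R sum_distrib_left)
  finally show ?thesis by (simp add: R_def)
qed

lemma ptrace_B_Herm:
  assumes "\<rho> \<in> BS (Suc (Suc r))"
  shows "ptrace_B (Suc r) \<rho> \<in> Herm"
proof -
  have "ptrace_B (Suc r) \<rho> $ p $ q = cnj (ptrace_B (Suc r) \<rho> $ q $ p)" for p q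
  proof -
    have "\<rho> (fst p # snd p # h) (fst q # snd q # h) = cnj (\<rho> (fst q # snd q # h) (fst p # snd p # h))"
      if "h \<in> idx r" for h
    proof -
      have "fst p # snd p # h \<in> idx (Suc (Suc r))" "fst q # snd q # h \<in> idx (Suc (Suc r))"
        using that by (simp_all add: idx_def)
      then show ?thesis using assms unfolding BS_def tHerm_def by blast
    qed
    then show ?thesis
      unfolding ptrace_B_def vec_lambda_beta cnj_sum by (intro sum.cong) simp_all
  qed
  then show ?thesis unfolding Herm_def by blast
qed

lemma M_ST_TB_in_DPS_dual_iff:
  fixes S :: "real^'n::finite^'n"
  assumes T: "T \<in> Herm"
  shows "M_ST_TB S T \<in> DPS_dual (Suc r) \<longleftrightarrow> A_ST S T \<in> K_cone r"
proof -
  \<comment> \<open>The level is \<open>t = Suc r\<close>, so there are \<open>r + 2\<close> tensor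
    factors and \<open>P\<close> is homogeneous of degree \<open>2 * (r + 2)\<close>.\<close>
  let ?m = "Suc (Suc r)"
  define a where "a = (\<lambda>xs. A_ST S T $ (xs ! 0) $ (xs ! 1))"
  define P :: "'n rpoly" where
    "P = (\<Sum>xs\<in>idx ?m. Poly_Mapping.single (expo xs + expo xs) (a xs))"
  have K: "A_ST S T \<in> K_cone r \<longleftrightarrow> sum_of_squares P"
    by (simp add: K_cone_def A_ST_Sym K_poly_expand P_def a_def)
  have tr: "trace (M_ST_TB S T ** ptrace_B (Suc r) \<rho>)
      = (\<Sum>xs\<in>idx ?m. complex_of_real (a xs) * \<rho> xs xs)" if "\<rho> \<in> BS ?m" for \<rho>
    unfolding a_def by (rule trace_M_ST_TB_ptrace_B[OF T that])
  show ?thesis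
    unfolding K
  proof
    assume dual: "M_ST_TB S T \<in> DPS_dual (Suc r)"
    show "sum_of_squares P"
    proof (rule ccontr)
      assume "\<not> sum_of_squares P"
      moreover have "keys P \<subseteq> (\<lambda>(x, y). x + y) ` (expo ` idx ?m \<times> expo ` idx ?m)"
      proof -
        have "keys P \<subseteq> (\<Union>xs\<in>idx ?m. keys (Poly_Mapping.single (expo xs + expo xs) (a xs)))"
          unfolding P_def by (rule keys_sum)
        then show ?thesis by (fastforce split: if_splits)
      qed
      ultimately obtain l where l: "lin_form l P < 0"
        "psd_on (idx ?m) (\<lambda>(is, js). l (expo is + expo js))"
        using ex_separating_form by blast
      \<comment> \<open>The form gives a matrix whose partial trace lies in
        \<open>DPS (Suc r)\<close>, but whose pairing with \<open>M_ST_TB S T\<close> is the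
        negative number \<open>lin_form l P\<close>.\<close>
      have BS: "tmat_of_form l \<in> BS ?m" by (rule tmat_of_form_BS)
      have "tpsd ?m (ptrans_B s (tmat_of_form l))" for s
        by (rule tpsd_ptrans_B_tmat_of_form[OF l(2)]) simp
      then have "ptrace_B (Suc r) (tmat_of_form l) \<in> DPS (Suc r)"
        unfolding DPS_def using BS ptrace_B_Herm[OF BS] by auto
      then have "0 \<le> trace (M_ST_TB S T ** ptrace_B (Suc r) (tmat_of_form l))"
        using dual unfolding DPS_dual_def by blast
      also have "\<dots> = complex_of_real (lin_form l P)"
        unfolding tr[OF BS] P_def lin_form_sum of_real_sum
        by (intro sum.cong refl) (simp add: tmat_of_form_def mult.commute)
      finally show False using l(1) by (simp add: less_eq_complex_def)
    qed
  next
    assume sos: "sum_of_squares P"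
    have "0 \<le> trace (M_ST_TB S T ** R)" if "R \<in> DPS (Suc r)" for R
    proof -
      from that obtain \<rho> where \<rho>: "\<rho> \<in> BS ?m" "\<And>s. s \<le> ?m div 2 \<Longrightarrow> tpsd ?m (ptrans_B s \<rho>)"
        "ptrace_B (Suc r) \<rho> = R"
        unfolding DPS_def by auto
      have "0 \<le> (\<Sum>xs\<in>idx ?m. complex_of_real (a xs) * \<rho> xs xs)"
        using sos unfolding P_def by (intro sum_squares_imp_trace_nonneg \<rho>) auto
      then show ?thesis using tr[OF \<rho>(1)] \<rho>(3) by simp
    qed
    then show "M_ST_TB S T \<in> DPS_dual (Suc r)"
      unfolding DPS_dual_def using M_ST_TB_Herm[OF T] by blast
  qed
qed

theorem theorem4p4:
  fixes S :: "real^'n::finite^'n" and T :: "complex^'n^'n" and t :: nat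
  assumes "T \<in> Herm" and "t \<ge> 1"
  shows "(M_ST_TB S T \<in> DPS_dual t \<longleftrightarrow> A_ST S T \<in> K_cone (t - 1)) \<and>
         (\<forall>A \<in> (Sym :: (real^'n^'n) set). M_ST_TB A 0 \<in> DPS_dual t \<longleftrightarrow> A \<in> K_cone (t - 1))"
proof -
  have t: "Suc (t - 1) = t" using assms(2) by simp
  have "A_ST A 0 = A" if "A \<in> Sym" for A :: "real^'n^'n"
  proof -
    have "A $ j $ i = A $ i $ j" for i j
      using that by (metis (mono_tags) Sym_def mem_Collect_eq transpose_def vec_lambda_beta)
    then show ?thesis by (simp add: A_ST_def map_matrix_def transpose_def vec_eq_iff)
  qed
  moreover have "(0 :: complex^'n^'n) \<in> Herm" by (simp add: Herm_def)
  ultimately show ?thesis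
    using M_ST_TB_in_DPS_dual_iff[of T S "t - 1"] M_ST_TB_in_DPS_dual_iff[of 0 _ "t - 1"] assms(1)
    unfolding t by metis
qed

end
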